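(* Let $G$ and $G'$ each be both a groupoid and a topological space (no compatibility assumed) with Hausdorff unit space and gradings $\mathsf{c}:G\to\Gamma$, $\mathsf{c}':G'\to\Gamma$ into the same groupoid $\Gamma$, and let $Y$ and $Y'$ be unital $1$-cancellative semigroups. Let $A\subseteq{}_Y\mathcal{O}_\mathsf{h}(G)$ and $A'\subseteq{}_{Y'}\mathcal{O}_\mathsf{h}(G')$ be semigroups on which the product is given by $ab(gh)=a(g)b(h)$ whenever $\mathrm{dom}(a)$ or $\mathrm{dom}(b)$ is a bisection. Let $Z,D,S,N\subseteq A$ and $Z',D',S',N'\subseteq A'$ be the subsets defined in the context. If (1) $D$ and $D'$ are exhaustive, (2) $S=N$ is $Z$-bumpy and $S'=N'$ is $Z'$-bumpy, and (3) $A$ and $A'$ are diagonally isomorphic graded semigroups (there is a diagonal-preserving graded semigroup isomorphism $A\to A'$), then $G$ and $G'$ are isomorphic graded étale groupoids, i.e. $G$ and $G'$ are étale and there is a groupoid isomorphism $\psi:G\to G'$ that is a homeomorphism with $\mathsf{c}'\circ\psi=\mathsf{c}$.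
   Context: For a groupoid $G$: $\mathsf{s}(g)=g^{-1}g$, $\mathsf{r}(g)=gg^{-1}$; $G^0$ is the set of units; $gh$ is defined iff $\mathsf{s}(g)=\mathsf{r}(h)$; for $X,X'\subseteq G$, $XX'=\{xx':x\in X,x'\in X',\mathsf{s}(x)=\mathsf{r}(x')\}$ and $X^{-1}=\{x^{-1}:x\in X\}$. $\mathcal{O}(G)$ is the topology of $G$; $\mathrm{int}$ denotes interior in $G$. A bisection is $B\subseteq G$ with $BB^{-1}\cup B^{-1}B\subseteq G^0$. $G^{\mathrm{iso}}=\{g\in G:\mathsf{s}(g)=\mathsf{r}(g)\}$; an isosection is $I\subseteq G$ with $II^{-1}\cup I^{-1}I\subseteq G^{\mathrm{iso}}$. $G$ is étale if inversion and multiplication are continuous and $\mathsf{s}$ is a local homeomorphism onto an open subset of $G$. A grading $\mathsf{c}:G\to\Gamma$ is a map with $\mathsf{c}(xy)=\mathsf{c}(x)\mathsf{c}(y)$ (the right side being defined) whenever $xy$ is defined. $H\subseteq G$ is homogeneous if $\mathsf{c}$ is constant on $H$; $\mathcal{O}_\mathsf{h}(G)$ and $\mathcal{B}^\circ_\mathsf{h}(G)$ are the sets of homogeneous open subsets and homogeneous open bisections. A unital semigroup $Y$ is $1$-cancellative if for all $x,y\in Y$: $xy=x\Leftrightarrow y=1\Leftrightarrow yx=x$. $Y^\times$ is its set of invertible elements and $\mathsf{Z}(Y)$ its centre. For a family $\mathcal{X}$ of subsets of $G$, ${}_Y\mathcal{X}$ is the set of partial functions $a$ from $G$ to $Y$ with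 domain $\mathrm{dom}(a)\in\mathcal{X}$; $\mathrm{ran}(a)$ is the range; for $W\subseteq Y$, $[W]a=\{g\in\mathrm{dom}(a):a(g)\in W\}$, $[1]a=[\{1\}]a$. The assumption on $A$: it is a set of partial functions with homogeneous open domains carrying an associative product such that, whenever $\mathrm{dom}(a)$ or $\mathrm{dom}(b)$ is a bisection, $ab$ is the function with domain $\mathrm{dom}(a)\mathrm{dom}(b)$ given by $ab(gh)=a(g)b(h)$ for $g\in\mathrm{dom}(a)$, $h\in\mathrm{dom}(b)$, $\mathsf{s}(g)=\mathsf{r}(h)$. (Nothing but associativity is assumed about other products.) Likewise for $A'$. Subsets of $A$ (and analogously primed subsets of $A'$): $Z=\{a\in A:\mathrm{dom}(a)\subseteq G^0,\ \mathrm{ran}(a)\subseteq\mathsf{Z}(Y)\}$; $D=\{a\in A:\mathrm{dom}(a)\subseteq G^0\}$; $S=\{a\in A:\mathrm{dom}(a)\text{ is a bisection}\}$; $N=\{a\in A:\mathrm{dom}(a)\text{ is an isosection}\}$. $D$ is exhaustive if for all $g\in G^0$ and $y\in Y$ there is $d\in D$ with $d(g)=y$. $S\subseteq{}_Y\mathcal{B}^\circ_\mathsf{h}(G)$ is $Z$-bumpy if: (1-Proper) $[1]a$ is compact for all $a\in S$; (Urysohn) the empty function $\emptyset$ is in $S$, and whenever $g\in O\in\mathcal{O}(G)$ there is $a\in S$ with $\mathrm{dom}(a)\subseteq O$ and $g\in\mathrm{int}([Y^\times]a)$; ($Z$-Involutive) whenever $a\in S$ and $g\in\mathrm{int}([Y^\times]a)$,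 there is $b\in S$ such that $ab,ba\in Z$ and $g^{-1}\in\mathrm{int}(\{h\in G:a(h^{-1})=b(h)^{-1}\})$. For a nonempty function $a\in A$, $\mathsf{c}(a)\in\Gamma$ is the element with $\mathsf{c}[\mathrm{dom}(a)]=\{\mathsf{c}(a)\}$, and similarly $\mathsf{c}'$ on $A'$. A semigroup isomorphism $\phi:A\to A'$ is graded if $\mathsf{c}(a)=\mathsf{c}'(\phi(a))$ for all $a\in A\setminus\{\emptyset\}$, and diagonal-preserving if $\phi[D]=D'$. *)

theory Defs
  imports
    "HOL-Analysis.Abstract_Topology_2"
    "HOL-Analysis.Product_Topology"
    "HOL-Analysis.T1_Spaces"
    "HOL-Algebra.Group"
begin

section \<open>Groupoids\<close>

text \<open>
  A groupoid is a set of arrows with a total inverse and a partial product. HOL functions being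
  total, \<open>gmul G g h\<close> is meaningful only for composable arrows, i.e. \<open>gsrc G g = grng G h\<close>,
  and every definition below uses it only there.
\<close>

record 'g groupoid_data = "'g partial_object" +
  gmul :: "'g \<Rightarrow> 'g \<Rightarrow> 'g"
  ginv :: "'g \<Rightarrow> 'g"

definition gsrc :: "'g groupoid_data \<Rightarrow> 'g \<Rightarrow> 'g" where
  "gsrc G g = gmul G (ginv G g) g"

definition grng :: "'g groupoid_data \<Rightarrow> 'g \<Rightarrow> 'g" where
  "grng G g = gmul G g (ginv G g)"

text \<open>
  The usual algebraic axioms. The arrows \<open>g\<inverse>\<close> and \<open>g\<close> are composable by \<open>inv_inv\<close>, and
  \<open>g \<cdot> s(g) = g = r(g) \<cdot> g\<close> are instances of the two cancellation axioms.
\<close>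

locale groupoid =
  fixes G :: "'g groupoid_data"
  assumes inv_closed: "g \<in> carrier G \<Longrightarrow> ginv G g \<in> carrier G"
    and mul_closed: "\<lbrakk>g \<in> carrier G; h \<in> carrier G; gsrc G g = grng G h\<rbrakk>
      \<Longrightarrow> gmul G g h \<in> carrier G"
    and inv_inv: "g \<in> carrier G \<Longrightarrow> ginv G (ginv G g) = g"
    and src_mul: "\<lbrakk>g \<in> carrier G; h \<in> carrier G; gsrc G g = grng G h\<rbrakk>
      \<Longrightarrow> gsrc G (gmul G g h) = gsrc G h"
    and rng_mul: "\<lbrakk>g \<in> carrier G; h \<in> carrier G; gsrc G g = grng G h\<rbrakk>
      \<Longrightarrow> grng G (gmul G g h) = grng G g"
    and assoc: "\<lbrakk>g \<in> carrier G; h \<in> carrier G; k \<in> carrier G;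
        gsrc G g = grng G h; gsrc G h = grng G k\<rbrakk>
      \<Longrightarrow> gmul G (gmul G g h) k = gmul G g (gmul G h k)"
    and left_cancel: "\<lbrakk>g \<in> carrier G; h \<in> carrier G; gsrc G g = grng G h\<rbrakk>
      \<Longrightarrow> gmul G (ginv G g) (gmul G g h) = h"
    and right_cancel: "\<lbrakk>g \<in> carrier G; h \<in> carrier G; gsrc G g = grng G h\<rbrakk>
      \<Longrightarrow> gmul G (gmul G g h) (ginv G h) = g"

definition gunits :: "'g groupoid_data \<Rightarrow> 'g set" where
  "gunits G = gsrc G ` carrier G"

definition giso :: "'g groupoid_data \<Rightarrow> 'g set" where
  "giso G = {g \<in> carrier G. gsrc G g = grng G g}"

definition gset_mul :: "'g groupoid_data \<Rightarrow> 'g set \<Rightarrow> 'g set \<Rightarrow> 'g set" where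
  "gset_mul G X X' = {gmul G x x' | x x'. x \<in> X \<and> x' \<in> X' \<and> gsrc G x = grng G x'}"

definition gset_inv :: "'g groupoid_data \<Rightarrow> 'g set \<Rightarrow> 'g set" where
  "gset_inv G X = ginv G ` X"

definition bisection :: "'g groupoid_data \<Rightarrow> 'g set \<Rightarrow> bool" where
  "bisection G B \<longleftrightarrow> B \<subseteq> carrier G \<and>
     gset_mul G B (gset_inv G B) \<union> gset_mul G (gset_inv G B) B \<subseteq> gunits G"

definition isosection :: "'g groupoid_data \<Rightarrow> 'g set \<Rightarrow> bool" where
  "isosection G I \<longleftrightarrow> I \<subseteq> carrier G \<and>
     gset_mul G I (gset_inv G I) \<union> gset_mul G (gset_inv G I) I \<subseteq> giso G"

definition grading :: "'g groupoid_data \<Rightarrow> 'k groupoid_data \<Rightarrow> ('g \<Rightarrow> 'k) \<Rightarrow> bool" where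
  "grading G \<Gamma> c \<longleftrightarrow> c \<in> carrier G \<rightarrow> carrier \<Gamma> \<and>
     (\<forall>x\<in>carrier G. \<forall>y\<in>carrier G. gsrc G x = grng G y \<longrightarrow>
        gsrc \<Gamma> (c x) = grng \<Gamma> (c y) \<and> c (gmul G x y) = gmul \<Gamma> (c x) (c y))"

definition groupoid_iso :: "'g groupoid_data \<Rightarrow> 'h groupoid_data \<Rightarrow> ('g \<Rightarrow> 'h) \<Rightarrow> bool" where
  "groupoid_iso G H \<psi> \<longleftrightarrow> bij_betw \<psi> (carrier G) (carrier H) \<and>
     (\<forall>x\<in>carrier G. \<forall>y\<in>carrier G. gsrc G x = grng G y \<longrightarrow>
        gsrc H (\<psi> x) = grng H (\<psi> y) \<and> \<psi> (gmul G x y) = gmul H (\<psi> x) (\<psi> y))"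


section \<open>Topology on groupoids\<close>

definition local_homeomorphism :: "'a topology \<Rightarrow> 'b topology \<Rightarrow> ('a \<Rightarrow> 'b) \<Rightarrow> bool" where
  "local_homeomorphism X Y f \<longleftrightarrow> f \<in> topspace X \<rightarrow> topspace Y \<and>
     (\<forall>x\<in>topspace X. \<exists>U. openin X U \<and> x \<in> U \<and> openin Y (f ` U) \<and>
        homeomorphic_map (subtopology X U) (subtopology Y (f ` U)) f)"

definition etale_groupoid :: "'g groupoid_data \<Rightarrow> 'g topology \<Rightarrow> bool" where
  "etale_groupoid G T \<longleftrightarrow> groupoid G \<and> topspace T = carrier G \<and>
     continuous_map T T (ginv G) \<and>
     continuous_map
       (subtopology (prod_topology T T)
          {(g, h). g \<in> carrier G \<and> h \<in> carrier G \<and> gsrc G g = grng G h})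
       T (\<lambda>(g, h). gmul G g h) \<and>
     openin T (gsrc G ` carrier G) \<and>
     local_homeomorphism T (subtopology T (gsrc G ` carrier G)) (gsrc G)"

definition homogeneous_opens :: "'g topology \<Rightarrow> ('g \<Rightarrow> 'k) \<Rightarrow> 'g set set" where
  "homogeneous_opens T c = {U. openin T U \<and> c constant_on U}"

definition homogeneous_open_bisections ::
  "'g groupoid_data \<Rightarrow> 'g topology \<Rightarrow> ('g \<Rightarrow> 'k) \<Rightarrow> 'g set set" where
  "homogeneous_open_bisections G T c = {B \<in> homogeneous_opens T c. bisection G B}"


section \<open>One-cancellative monoids\<close>

definition one_cancellative :: "'y monoid \<Rightarrow> bool" where
  "one_cancellative Y \<longleftrightarrow> (\<forall>x\<in>carrier Y. \<forall>y\<in>carrier Y.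
     (x \<otimes>\<^bsub>Y\<^esub> y = x \<longleftrightarrow> y = \<one>\<^bsub>Y\<^esub>) \<and> (y \<otimes>\<^bsub>Y\<^esub> x = x \<longleftrightarrow> y = \<one>\<^bsub>Y\<^esub>))"

definition monoid_centre :: "'y monoid \<Rightarrow> 'y set" where
  "monoid_centre Y = {z \<in> carrier Y. \<forall>y\<in>carrier Y. z \<otimes>\<^bsub>Y\<^esub> y = y \<otimes>\<^bsub>Y\<^esub> z}"


section \<open>Semigroups of partial functions\<close>

text \<open>
  Partial functions from \<open>G\<close> to \<open>Y\<close> are maps \<open>'g \<rightharpoonup> 'y\<close>; the empty function is \<open>Map.empty\<close>.
\<close>

definition partial_functions :: "'y monoid \<Rightarrow> 'g set set \<Rightarrow> ('g \<rightharpoonup> 'y) set" where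
  "partial_functions Y \<X> = {a. dom a \<in> \<X> \<and> ran a \<subseteq> carrier Y}"

definition level_set :: "'y set \<Rightarrow> ('g \<rightharpoonup> 'y) \<Rightarrow> 'g set" where
  "level_set W a = {g. \<exists>y\<in>W. a g = Some y}"

text \<open>
  The product \<open>m\<close> on \<open>A\<close> is an arbitrary associative operation that is given by the
  pointwise formula as soon as one of the two domains is a bisection.
\<close>

definition function_semigroup ::
  "'g groupoid_data \<Rightarrow> 'g topology \<Rightarrow> ('g \<Rightarrow> 'k) \<Rightarrow> 'y monoid \<Rightarrow>
   ('g \<rightharpoonup> 'y) set \<Rightarrow> (('g \<rightharpoonup> 'y) \<Rightarrow> ('g \<rightharpoonup> 'y) \<Rightarrow> ('g \<rightharpoonup> 'y)) \<Rightarrow> bool" where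
  "function_semigroup G T c Y A m \<longleftrightarrow>
     A \<subseteq> partial_functions Y (homogeneous_opens T c) \<and>
     (\<forall>a\<in>A. \<forall>b\<in>A. m a b \<in> A) \<and>
     (\<forall>a\<in>A. \<forall>b\<in>A. \<forall>d\<in>A. m (m a b) d = m a (m b d)) \<and>
     (\<forall>a\<in>A. \<forall>b\<in>A. bisection G (dom a) \<or> bisection G (dom b) \<longrightarrow>
        dom (m a b) = gset_mul G (dom a) (dom b) \<and>
        (\<forall>g\<in>dom a. \<forall>h\<in>dom b. gsrc G g = grng G h \<longrightarrow>
           m a b (gmul G g h) = Some (the (a g) \<otimes>\<^bsub>Y\<^esub> the (b h))))"

definition Z_part :: "'g groupoid_data \<Rightarrow> 'y monoid \<Rightarrow> ('g \<rightharpoonup> 'y) set \<Rightarrow> ('g \<rightharpoonup> 'y) set" where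
  "Z_part G Y A = {a \<in> A. dom a \<subseteq> gunits G \<and> ran a \<subseteq> monoid_centre Y}"

definition D_part :: "'g groupoid_data \<Rightarrow> ('g \<rightharpoonup> 'y) set \<Rightarrow> ('g \<rightharpoonup> 'y) set" where
  "D_part G A = {a \<in> A. dom a \<subseteq> gunits G}"

definition S_part :: "'g groupoid_data \<Rightarrow> ('g \<rightharpoonup> 'y) set \<Rightarrow> ('g \<rightharpoonup> 'y) set" where
  "S_part G A = {a \<in> A. bisection G (dom a)}"

definition N_part :: "'g groupoid_data \<Rightarrow> ('g \<rightharpoonup> 'y) set \<Rightarrow> ('g \<rightharpoonup> 'y) set" where
  "N_part G A = {a \<in> A. isosection G (dom a)}"

definition exhaustive :: "'g groupoid_data \<Rightarrow> 'y monoid \<Rightarrow> ('g \<rightharpoonup> 'y) set \<Rightarrow> bool" where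
  "exhaustive G Y D \<longleftrightarrow> (\<forall>g\<in>gunits G. \<forall>y\<in>carrier Y. \<exists>d\<in>D. d g = Some y)"

definition one_proper :: "'g topology \<Rightarrow> 'y monoid \<Rightarrow> ('g \<rightharpoonup> 'y) set \<Rightarrow> bool" where
  "one_proper T Y S \<longleftrightarrow> (\<forall>a\<in>S. compactin T (level_set {\<one>\<^bsub>Y\<^esub>} a))"

definition urysohn :: "'g topology \<Rightarrow> 'y monoid \<Rightarrow> ('g \<rightharpoonup> 'y) set \<Rightarrow> bool" where
  "urysohn T Y S \<longleftrightarrow> Map.empty \<in> S \<and>
     (\<forall>U g. openin T U \<and> g \<in> U \<longrightarrow>
        (\<exists>a\<in>S. dom a \<subseteq> U \<and> g \<in> T interior_of (level_set (Units Y) a)))"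

text \<open>
  An equation such as \<open>a(h\<inverse>) = b(h)\<inverse>\<close> between partial expressions is read as: both sides are
  defined (in particular \<open>b(h)\<close> is invertible in \<open>Y\<close>) and they agree.
\<close>

definition Z_involutive ::
  "'g groupoid_data \<Rightarrow> 'g topology \<Rightarrow> 'y monoid \<Rightarrow>
   (('g \<rightharpoonup> 'y) \<Rightarrow> ('g \<rightharpoonup> 'y) \<Rightarrow> ('g \<rightharpoonup> 'y)) \<Rightarrow> ('g \<rightharpoonup> 'y) set \<Rightarrow> ('g \<rightharpoonup> 'y) set \<Rightarrow> bool" where
  "Z_involutive G T Y m Z S \<longleftrightarrow>
     (\<forall>a\<in>S. \<forall>g\<in>T interior_of (level_set (Units Y) a). \<exists>b\<in>S.
        m a b \<in> Z \<and> m b a \<in> Z \<and>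
        ginv G g \<in> T interior_of
          {h \<in> carrier G. \<exists>y\<in>Units Y. b h = Some y \<and> a (ginv G h) = Some (inv\<^bsub>Y\<^esub> y)})"

definition bumpy ::
  "'g groupoid_data \<Rightarrow> 'g topology \<Rightarrow> ('g \<Rightarrow> 'k) \<Rightarrow> 'y monoid \<Rightarrow>
   (('g \<rightharpoonup> 'y) \<Rightarrow> ('g \<rightharpoonup> 'y) \<Rightarrow> ('g \<rightharpoonup> 'y)) \<Rightarrow> ('g \<rightharpoonup> 'y) set \<Rightarrow> ('g \<rightharpoonup> 'y) set \<Rightarrow> bool" where
  "bumpy G T c Y m Z S \<longleftrightarrow>
     S \<subseteq> partial_functions Y (homogeneous_open_bisections G T c) \<and>
     one_proper T Y S \<and> urysohn T Y S \<and> Z_involutive G T Y m Z S"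

definition semigroup_iso ::
  "'a set \<Rightarrow> ('a \<Rightarrow> 'a \<Rightarrow> 'a) \<Rightarrow> 'b set \<Rightarrow> ('b \<Rightarrow> 'b \<Rightarrow> 'b) \<Rightarrow> ('a \<Rightarrow> 'b) \<Rightarrow> bool" where
  "semigroup_iso A m B n \<phi> \<longleftrightarrow> bij_betw \<phi> A B \<and>
     (\<forall>a\<in>A. \<forall>b\<in>A. \<phi> (m a b) = n (\<phi> a) (\<phi> b))"

text \<open>Meaningful for nonempty \<open>a\<close> with homogeneous domain.\<close>

definition degree :: "('g \<Rightarrow> 'k) \<Rightarrow> ('g \<rightharpoonup> 'y) \<Rightarrow> 'k" where
  "degree c a = (THE \<gamma>. c ` dom a = {\<gamma>})"

text \<open>
  When the empty function lies in both semigroups it is the zero of each, so a semigroup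
  isomorphism sends nonempty functions to nonempty ones and both degrees below are meaningful.
\<close>

definition graded_map ::
  "('g \<Rightarrow> 'k) \<Rightarrow> ('h \<Rightarrow> 'k) \<Rightarrow> ('g \<rightharpoonup> 'y) set \<Rightarrow> (('g \<rightharpoonup> 'y) \<Rightarrow> ('h \<rightharpoonup> 'z)) \<Rightarrow> bool" where
  "graded_map c c' A \<phi> \<longleftrightarrow> (\<forall>a\<in>A - {Map.empty}. degree c a = degree c' (\<phi> a))"

end

theory Submission
  imports Defs
begin

text \<open>
  The points of the groupoid are recovered from the semigroup. A point \<open>g\<close> is represented by the
  set of its bumps: the elements of \<open>S\<close> that take invertible values near \<open>g\<close>. Bumps are compared by
  domination: \<open>a\<close> is dominated by \<open>b\<close> if some \<open>s \<in> S\<close> satisfies \<open>a s b = a = b s a\<close> with \<open>a s\<close>, \<open>s b\<close>,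
  \<open>b s\<close> in \<open>D\<close>. By 1-cancellation \<open>s\<close> then inverts \<open>b\<close> on \<open>dom a\<close>, and the set \<open>[1](s b)\<close>, compact by
  1-properness, lies between the sets of sources of \<open>dom a\<close> and \<open>dom b\<close> (\<open>dominatedD\<close>). Conversely,
  involutivity shows that a bump at \<open>g\<close> dominates every element of \<open>S\<close> supported close enough to
  \<open>g\<close>, so the bumps at \<open>g\<close> are directed downwards (\<open>dominated_near\<close>, \<open>bumps_at_directed\<close>).

  An isomorphism \<open>\<phi>\<close> that respects \<open>S\<close> and \<open>D\<close> respects domination. The sources of the domains of
  the images \<open>\<phi> a\<close>, for the bumps \<open>a\<close> at \<open>g\<close>, thus form a directed family interlaced with compact
  subsets of a Hausdorff space. They have a common point, and above it lies an arrow \<open>g'\<close> whose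
  bumps include all the \<open>\<phi> a\<close> (\<open>transported_point\<close>). Distinct points have incomparable sets of bumps,
  so the same argument for the inverse of \<open>\<phi>\<close> shows that \<open>\<phi>\<close> maps the bumps at \<open>g\<close> onto the bumps
  at \<open>g'\<close>. The bijection \<open>\<psi>\<close> that takes \<open>g\<close> to \<open>g'\<close> is a homeomorphism because the sets of points
  having a given bump form a basis, multiplicative because bumps at \<open>g\<close> and \<open>h\<close> multiply to bumps
  at \<open>g h\<close>, and graded because \<open>\<phi>\<close> is.

  It remains to see that \<open>\<phi>\<close> respects \<open>S\<close>, of which only \<open>D\<close> is preserved by assumption. This is
  where \<open>S = N\<close> enters: a domain fails to be an isosection if it has two arrows with equal sources
  and different ranges, or conversely, and as units can be separated by elements of \<open>D\<close> this can be
  expressed by the emptiness of products with elements of \<open>D\<close> (\<open>S_iff\<close>).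

  The groupoid is etale because every open set is a union of domains of elements of \<open>S\<close> and domains
  of products are open, so that products of open sets are open; inverses of open sets are open by
  involutivity. Continuity of the operations then follows from inclusions such as
  \<open>B (B\<inverse> B') \<subseteq> B'\<close> for bisections \<open>B\<close>.
\<close>

section \<open>Arithmetic of groupoids\<close>

context groupoid
begin

lemma src_inv: "g \<in> carrier G \<Longrightarrow> gsrc G (ginv G g) = grng G g"
  by (simp add: gsrc_def grng_def inv_inv)

lemma rng_inv: "g \<in> carrier G \<Longrightarrow> grng G (ginv G g) = gsrc G g"
  by (simp add: gsrc_def grng_def inv_inv)

lemma src_closed: "g \<in> carrier G \<Longrightarrow> gsrc G g \<in> carrier G"
  using mul_closed[of "ginv G g" g] inv_closed[of g] src_inv[of g] by (simp add: gsrc_def[of G g])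

lemma src_unit: "g \<in> carrier G \<Longrightarrow> gsrc G g \<in> gunits G"
  by (simp add: gunits_def)

lemma rng_unit: "g \<in> carrier G \<Longrightarrow> grng G g \<in> gunits G"
  using src_unit[of "ginv G g"] inv_closed src_inv by simp

lemma unit_closed: "x \<in> gunits G \<Longrightarrow> x \<in> carrier G"
  by (auto simp: gunits_def src_closed)

lemma unit_src: "x \<in> gunits G \<Longrightarrow> gsrc G x = x"
  using src_mul[of "ginv G g" g for g] inv_closed src_inv
  by (fastforce simp: gunits_def gsrc_def)

lemma unit_rng: "x \<in> gunits G \<Longrightarrow> grng G x = x"
proof -
  assume "x \<in> gunits G"
  then obtain g where g: "g \<in> carrier G" "x = gsrc G g" by (auto simp: gunits_def)
  have "grng G x = grng G (ginv G g)"
    using rng_mul[of "ginv G g" g] inv_closed[of g] src_inv[of g] g by (simp add: gsrc_def[of G g])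
  then show ?thesis using g rng_inv by simp
qed

lemma mul_src: "g \<in> carrier G \<Longrightarrow> gmul G g (gsrc G g) = g"
  using left_cancel[of "ginv G g" g] inv_closed[of g] src_inv[of g]
  by (simp add: gsrc_def[of G g] inv_inv)

lemma rng_mul_self: "g \<in> carrier G \<Longrightarrow> gmul G (grng G g) g = g"
  using right_cancel[of g "ginv G g"] inv_closed[of g] rng_inv[of g]
  by (simp add: grng_def[of G g] inv_inv)

lemma mul_unit:
  "\<lbrakk>g \<in> carrier G; x \<in> gunits G; gsrc G g = grng G x\<rbrakk> \<Longrightarrow> gmul G g x = g"
  using mul_src unit_rng by metis

lemma unit_mul:
  "\<lbrakk>g \<in> carrier G; x \<in> gunits G; gsrc G x = grng G g\<rbrakk> \<Longrightarrow> gmul G x g = g"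
  using rng_mul_self unit_src by metis

lemma unit_inv: "x \<in> gunits G \<Longrightarrow> ginv G x = x"
  by (metis gsrc_def inv_closed mul_src src_inv unit_closed unit_rng unit_src)

lemma product_unit_imp_inverse:
  assumes "g \<in> carrier G" "h \<in> carrier G" "gsrc G g = grng G h" "gmul G g h \<in> gunits G"
  shows "g = ginv G h"
  by (metis assms inv_closed right_cancel rng_inv src_mul unit_mul)

lemma product_unit_eq_src:
  assumes "g \<in> carrier G" "h \<in> carrier G" "gsrc G g = grng G h" "gmul G g h \<in> gunits G"
  shows "gmul G g h = gsrc G h"
  using product_unit_imp_inverse[OF assms] by (simp add: gsrc_def)

lemma gset_mulI: "\<lbrakk>g \<in> U; h \<in> V; gsrc G g = grng G h\<rbrakk> \<Longrightarrow> gmul G g h \<in> gset_mul G U V"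
  by (auto simp: gset_mul_def)

lemma bisection_iff:
  "bisection G B \<longleftrightarrow> B \<subseteq> carrier G \<and> inj_on (gsrc G) B \<and> inj_on (grng G) B"
proof
  assume B: "bisection G B"
  then have sub: "B \<subseteq> carrier G" by (simp add: bisection_def)
  have "g = h" if gh: "g \<in> B" "h \<in> B" "gsrc G g = gsrc G h" for g h
  proof -
    have "gmul G g (ginv G h) \<in> gset_mul G B (gset_inv G B)"
      using gh sub rng_inv unfolding gset_mul_def gset_inv_def by fastforce
    then have "gmul G g (ginv G h) \<in> gunits G" using B by (auto simp: bisection_def)
    then show ?thesis
      using product_unit_imp_inverse[of g "ginv G h"] gh sub inv_closed inv_inv rng_inv
      by (metis subsetD)
  qed
  moreover have "g = h" if gh: "g \<in> B" "h \<in> B" "grng G g = grng G h" for g h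
  proof -
    have "gmul G (ginv G g) h \<in> gset_mul G (gset_inv G B) B"
      using gh sub src_inv unfolding gset_mul_def gset_inv_def by fastforce
    then have "gmul G (ginv G g) h \<in> gunits G" using B by (auto simp: bisection_def)
    then show ?thesis
      using product_unit_imp_inverse[of "ginv G g" h] gh sub inv_closed inv_inv src_inv
      by (metis subsetD)
  qed
  ultimately show "B \<subseteq> carrier G \<and> inj_on (gsrc G) B \<and> inj_on (grng G) B"
    using sub by (auto simp: inj_on_def)
next
  assume B: "B \<subseteq> carrier G \<and> inj_on (gsrc G) B \<and> inj_on (grng G) B"
  have "gset_mul G B (gset_inv G B) \<subseteq> gunits G"
  proof
    fix x assume "x \<in> gset_mul G B (gset_inv G B)"
    then obtain g h where gh: "g \<in> B" "h \<in> B" "gsrc G g = grng G (ginv G h)" "x = gmul G g (ginv G h)"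
      by (auto simp: gset_mul_def gset_inv_def)
    then have "g = h" using B rng_inv by (metis inj_onD subsetD)
    then show "x \<in> gunits G" using gh B rng_unit by (auto simp: grng_def[symmetric])
  qed
  moreover have "gset_mul G (gset_inv G B) B \<subseteq> gunits G"
  proof
    fix x assume "x \<in> gset_mul G (gset_inv G B) B"
    then obtain g h where gh: "g \<in> B" "h \<in> B" "gsrc G (ginv G g) = grng G h" "x = gmul G (ginv G g) h"
      by (auto simp: gset_mul_def gset_inv_def)
    then have "g = h" using B src_inv by (metis inj_onD subsetD)
    then show "x \<in> gunits G" using gh B src_unit by (auto simp: gsrc_def[symmetric])
  qed
  ultimately show "bisection G B" using B by (auto simp: bisection_def)
qed

text \<open>
  The two implications in this equivalence are exchanged by swapping source and range, which
  allows \<open>S_iff\<close> to treat both by one argument.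
\<close>

lemma isosection_iff:
  "isosection G I \<longleftrightarrow> I \<subseteq> carrier G \<and>
     (\<forall>g\<in>I. \<forall>h\<in>I. gsrc G g = gsrc G h \<longleftrightarrow> grng G g = grng G h)"
proof (cases "I \<subseteq> carrier G")
  case I: True
  have right: "gmul G g (ginv G h) \<in> giso G \<longleftrightarrow> grng G g = grng G h"
    if "g \<in> I" "h \<in> I" "gsrc G g = gsrc G h" for g h
  proof -
    have gh: "g \<in> carrier G" "ginv G h \<in> carrier G" "gsrc G g = grng G (ginv G h)"
      using that I inv_closed rng_inv by auto
    show ?thesis
      using mul_closed[OF gh] src_mul[OF gh] rng_mul[OF gh] src_inv[of h] that I
      by (auto simp: giso_def)
  qed
  have left: "gmul G (ginv G g) h \<in> giso G \<longleftrightarrow> gsrc G g = gsrc G h"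
    if "g \<in> I" "h \<in> I" "grng G g = grng G h" for g h
  proof -
    have gh: "ginv G g \<in> carrier G" "h \<in> carrier G" "gsrc G (ginv G g) = grng G h"
      using that I inv_closed src_inv by auto
    show ?thesis
      using mul_closed[OF gh] src_mul[OF gh] rng_mul[OF gh] rng_inv[of g] that I
      by (auto simp: giso_def)
  qed
  have "gset_mul G I (gset_inv G I) \<subseteq> giso G \<longleftrightarrow>
      (\<forall>g\<in>I. \<forall>h\<in>I. gsrc G g = grng G (ginv G h) \<longrightarrow> gmul G g (ginv G h) \<in> giso G)"
    unfolding gset_mul_def gset_inv_def by blast
  also have "\<dots> \<longleftrightarrow> (\<forall>g\<in>I. \<forall>h\<in>I. gsrc G g = gsrc G h \<longrightarrow> grng G g = grng G h)"
    using right I rng_inv by (metis subsetD)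
  finally have 1: "gset_mul G I (gset_inv G I) \<subseteq> giso G \<longleftrightarrow>
    (\<forall>g\<in>I. \<forall>h\<in>I. gsrc G g = gsrc G h \<longrightarrow> grng G g = grng G h)" .
  have "gset_mul G (gset_inv G I) I \<subseteq> giso G \<longleftrightarrow>
      (\<forall>g\<in>I. \<forall>h\<in>I. gsrc G (ginv G g) = grng G h \<longrightarrow> gmul G (ginv G g) h \<in> giso G)"
    unfolding gset_mul_def gset_inv_def by blast
  also have "\<dots> \<longleftrightarrow> (\<forall>g\<in>I. \<forall>h\<in>I. grng G g = grng G h \<longrightarrow> gsrc G g = gsrc G h)"
    using left I src_inv by (metis subsetD)
  finally have 2: "gset_mul G (gset_inv G I) I \<subseteq> giso G \<longleftrightarrow>
    (\<forall>g\<in>I. \<forall>h\<in>I. grng G g = grng G h \<longrightarrow> gsrc G g = gsrc G h)" .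
  show ?thesis unfolding isosection_def Un_subset_iff 1 2 by blast
qed (simp add: isosection_def)

lemma bisection_gset_mul:
  assumes "bisection G B" "bisection G C"
  shows "bisection G (gset_mul G B C)"
proof -
  note bis = assms[unfolded bisection_iff]
  have "gset_mul G B C \<subseteq> carrier G" using bis mul_closed by (auto simp: gset_mul_def)
  moreover have "inj_on (gsrc G) (gset_mul G B C)"
  proof (rule inj_onI)
    fix x y assume "x \<in> gset_mul G B C" "y \<in> gset_mul G B C" and e: "gsrc G x = gsrc G y"
    then obtain g h g' h' where *: "g \<in> B" "h \<in> C" "gsrc G g = grng G h" "x = gmul G g h"
      "g' \<in> B" "h' \<in> C" "gsrc G g' = grng G h'" "y = gmul G g' h'" by (auto simp: gset_mul_def)
    then have "gsrc G h = gsrc G h'" using e src_mul bis by (metis subsetD)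
    then have "h = h'" using * bis by (metis inj_onD)
    then have "g = g'" using * bis by (metis inj_onD)
    then show "x = y" using * \<open>h = h'\<close> by simp
  qed
  moreover have "inj_on (grng G) (gset_mul G B C)"
  proof (rule inj_onI)
    fix x y assume "x \<in> gset_mul G B C" "y \<in> gset_mul G B C" and e: "grng G x = grng G y"
    then obtain g h g' h' where *: "g \<in> B" "h \<in> C" "gsrc G g = grng G h" "x = gmul G g h"
      "g' \<in> B" "h' \<in> C" "gsrc G g' = grng G h'" "y = gmul G g' h'" by (auto simp: gset_mul_def)
    then have "grng G g = grng G g'" using e rng_mul bis by (metis subsetD)
    then have "g = g'" using * bis by (metis inj_onD)
    then have "h = h'" using * bis by (metis inj_onD)
    then show "x = y" using * \<open>g = g'\<close> by simp
  qed
  ultimately show ?thesis by (simp add: bisection_iff)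
qed

lemma bisection_units: "U \<subseteq> gunits G \<Longrightarrow> bisection G U"
  by (auto simp: bisection_iff inj_on_def unit_src unit_rng unit_closed subset_iff)

lemma gset_mul_units_right:
  assumes "X \<subseteq> carrier G" "U \<subseteq> gunits G"
  shows "gset_mul G X U = {g \<in> X. gsrc G g \<in> U}"
proof
  show "gset_mul G X U \<subseteq> {g \<in> X. gsrc G g \<in> U}"
    using assms by (auto simp: gset_mul_def mul_unit unit_rng subset_iff)
  show "{g \<in> X. gsrc G g \<in> U} \<subseteq> gset_mul G X U"
    using assms mul_src unit_rng unfolding gset_mul_def by (force simp: subset_iff)
qed

lemma gset_mul_units_left:
  assumes "X \<subseteq> carrier G" "U \<subseteq> gunits G"
  shows "gset_mul G U X = {g \<in> X. grng G g \<in> U}"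
proof (intro equalityI subsetI)
  fix x assume "x \<in> gset_mul G U X"
  then obtain u g where *: "u \<in> U" "g \<in> X" "gsrc G u = grng G g" "x = gmul G u g"
    by (auto simp: gset_mul_def)
  then have "x = g" "grng G g = u" using assms unit_mul unit_src by (auto simp: subset_iff)
  then show "x \<in> {g \<in> X. grng G g \<in> U}" using * by simp
next
  fix x assume x: "x \<in> {g \<in> X. grng G g \<in> U}"
  then have "gmul G (grng G x) x = x" "gsrc G (grng G x) = grng G x"
    using assms rng_mul_self unit_src by auto
  then show "x \<in> gset_mul G U X" using x unfolding gset_mul_def by force
qed

end

section \<open>Semigroups of functions with enough bump functions\<close>

text \<open>
  One side of the isomorphism. All constructions below take place in this setting, so that they
  apply to both semigroups.
\<close>

locale bumpy_semigroup = groupoid G for G :: "'g groupoid_data" +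
  fixes T :: "'g topology" and c :: "'g \<Rightarrow> 'k" and Y :: "'y monoid"
    and A :: "('g \<rightharpoonup> 'y) set"
    and m :: "('g \<rightharpoonup> 'y) \<Rightarrow> ('g \<rightharpoonup> 'y) \<Rightarrow> ('g \<rightharpoonup> 'y)"
  assumes topspace: "topspace T = carrier G"
    and hausdorff: "Hausdorff_space (subtopology T (gunits G))"
    and Y_monoid: "monoid Y" and Y_cancel: "one_cancellative Y"
    and semigroup: "function_semigroup G T c Y A m"
    and S_eq_N: "S_part G A = N_part G A"
    and bumpy: "bumpy G T c Y m (Z_part G Y A) (S_part G A)"
begin

abbreviation "D \<equiv> D_part G A"
abbreviation "S \<equiv> S_part G A"

text \<open>
  The sets \<open>unit_locus a\<close> with \<open>a \<in> S\<close> form a basis of the topology. The bump functions at a point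
  are what represents this point inside the semigroup.
\<close>

definition unit_locus :: "('g \<rightharpoonup> 'y) \<Rightarrow> 'g set" where
  "unit_locus a = T interior_of (level_set (Units Y) a)"

definition bumps_at :: "'g \<Rightarrow> ('g \<rightharpoonup> 'y) set" where
  "bumps_at g = {a \<in> S. g \<in> unit_locus a}"

lemma dom_open: "a \<in> A \<Longrightarrow> openin T (dom a)"
  using semigroup by (auto simp: function_semigroup_def partial_functions_def homogeneous_opens_def)

lemma dom_carrier: "a \<in> A \<Longrightarrow> dom a \<subseteq> carrier G"
  using dom_open openin_subset topspace by blast

lemma dom_homogeneous: "a \<in> A \<Longrightarrow> c constant_on dom a"
  using semigroup by (auto simp: function_semigroup_def partial_functions_def homogeneous_opens_def)

lemma value_closed: "\<lbrakk>a \<in> A; a g = Some y\<rbrakk> \<Longrightarrow> y \<in> carrier Y"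
  using semigroup by (fastforce simp: function_semigroup_def partial_functions_def ran_def)

lemma m_closed: "\<lbrakk>a \<in> A; b \<in> A\<rbrakk> \<Longrightarrow> m a b \<in> A"
  using semigroup by (simp add: function_semigroup_def)

lemma m_assoc: "\<lbrakk>a \<in> A; b \<in> A; d \<in> A\<rbrakk> \<Longrightarrow> m (m a b) d = m a (m b d)"
  using semigroup by (simp add: function_semigroup_def)

lemma S_A: "a \<in> S \<Longrightarrow> a \<in> A"
  by (simp add: S_part_def)

lemma S_inj:
  assumes "a \<in> S"
  shows "inj_on (gsrc G) (dom a)" "inj_on (grng G) (dom a)"
  using assms by (auto simp: S_part_def bisection_iff)

lemma D_units: "d \<in> D \<Longrightarrow> dom d \<subseteq> gunits G"
  by (simp add: D_part_def)

lemma D_S: "d \<in> D \<Longrightarrow> d \<in> S"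
  by (simp add: D_part_def S_part_def bisection_units)

lemma D_A: "d \<in> D \<Longrightarrow> d \<in> A"
  by (simp add: D_part_def)

lemma S_imp_D: "\<lbrakk>a \<in> S; dom a \<subseteq> gunits G\<rbrakk> \<Longrightarrow> a \<in> D"
  by (simp add: D_part_def S_part_def)

lemma dom_m:
  "\<lbrakk>a \<in> A; b \<in> A; a \<in> S \<or> b \<in> S\<rbrakk> \<Longrightarrow> dom (m a b) = gset_mul G (dom a) (dom b)"
proof -
  assume "a \<in> A" "b \<in> A" "a \<in> S \<or> b \<in> S"
  moreover have "\<forall>a\<in>A. \<forall>b\<in>A. bisection G (dom a) \<or> bisection G (dom b) \<longrightarrow>
      dom (m a b) = gset_mul G (dom a) (dom b)"
    using semigroup unfolding function_semigroup_def by blast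
  ultimately show ?thesis by (auto simp only: S_part_def mem_Collect_eq)
qed

lemma m_value:
  assumes "a \<in> A" "b \<in> A" "a \<in> S \<or> b \<in> S" "a g = Some y" "b h = Some z" "gsrc G g = grng G h"
  shows "m a b (gmul G g h) = Some (y \<otimes>\<^bsub>Y\<^esub> z)"
proof -
  have "\<forall>a\<in>A. \<forall>b\<in>A. bisection G (dom a) \<or> bisection G (dom b) \<longrightarrow>
     (\<forall>g\<in>dom a. \<forall>h\<in>dom b. gsrc G g = grng G h \<longrightarrow>
           m a b (gmul G g h) = Some (the (a g) \<otimes>\<^bsub>Y\<^esub> the (b h)))"
    using semigroup by (auto simp: function_semigroup_def)
  moreover have "bisection G (dom a) \<or> bisection G (dom b)" using assms by (auto simp: S_part_def)
  ultimately show ?thesis using assms by (metis domI option.sel)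
qed

lemma m_S: "\<lbrakk>a \<in> S; b \<in> S\<rbrakk> \<Longrightarrow> m a b \<in> S"
  using dom_m[of a b] m_closed bisection_gset_mul by (auto simp: S_part_def)

text \<open>
  Products with diagonal functions are always given by the pointwise formula; the diagonal factor
  restricts and rescales the other one along the source or the range map.
\<close>

lemma dom_m_D: "\<lbrakk>a \<in> A; d \<in> D\<rbrakk> \<Longrightarrow> dom (m a d) = {g \<in> dom a. gsrc G g \<in> dom d}"
  using dom_m[of a d] gset_mul_units_right dom_carrier D_units D_A D_S by simp

lemma dom_D_m: "\<lbrakk>a \<in> A; d \<in> D\<rbrakk> \<Longrightarrow> dom (m d a) = {g \<in> dom a. grng G g \<in> dom d}"
  using dom_m[of d a] gset_mul_units_left dom_carrier D_units D_A D_S by simp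

lemma m_D_value:
  assumes "a \<in> A" "d \<in> D" "a g = Some y" "d (gsrc G g) = Some z"
  shows "m a d g = Some (y \<otimes>\<^bsub>Y\<^esub> z)"
proof -
  have "g \<in> carrier G" using assms dom_carrier by blast
  then show ?thesis
    using m_value[of a d g y "gsrc G g" z] assms D_A D_S mul_src unit_rng src_unit by simp
qed

lemma D_m_value:
  assumes "a \<in> A" "d \<in> D" "a g = Some y" "d (grng G g) = Some z"
  shows "m d a g = Some (z \<otimes>\<^bsub>Y\<^esub> y)"
proof -
  have "g \<in> carrier G" using assms dom_carrier by blast
  then show ?thesis
    using m_value[of d a "grng G g" z g y] assms D_A D_S rng_mul_self unit_src rng_unit by simp
qed

lemma m_D_D: "\<lbrakk>d \<in> D; e \<in> D\<rbrakk> \<Longrightarrow> m d e \<in> D"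
  using dom_m_D[of d e] D_units[of d] D_S by (intro S_imp_D m_S) (auto simp: D_A)

lemma empty_D: "Map.empty \<in> D"
proof -
  have "Map.empty \<in> S" using bumpy unfolding bumpy_def urysohn_def by blast
  then show ?thesis by (intro S_imp_D) auto
qed

lemma unit_locus_open: "openin T (unit_locus a)"
  by (simp add: unit_locus_def)

lemma unit_locus_value: "g \<in> unit_locus a \<Longrightarrow> \<exists>y\<in>Units Y. a g = Some y"
  using subsetD[OF interior_of_subset, of g T "level_set (Units Y) a"]
  by (simp add: unit_locus_def level_set_def)

lemma unit_locus_dom: "g \<in> unit_locus a \<Longrightarrow> g \<in> dom a"
  using unit_locus_value by blast

lemma unit_locusI:
  assumes "openin T U" "g \<in> U" "\<And>h. h \<in> U \<Longrightarrow> \<exists>y\<in>Units Y. a h = Some y"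
  shows "g \<in> unit_locus a"
  using interior_of_maximal[of U "level_set (Units Y) a" T] assms
  by (auto simp: unit_locus_def level_set_def)

lemma bumps_atD: "a \<in> bumps_at g \<Longrightarrow> a \<in> S" "a \<in> bumps_at g \<Longrightarrow> a \<in> A"
    "a \<in> bumps_at g \<Longrightarrow> g \<in> dom a"
  using unit_locus_dom by (auto simp: bumps_at_def S_A)

lemma bump_below:
  assumes "openin T U" "g \<in> U"
  obtains a where "a \<in> bumps_at g" "dom a \<subseteq> U" "a \<in> S" "a \<in> A" "g \<in> dom a"
    "openin T (dom a)" "dom a \<subseteq> carrier G"
proof -
  have "\<exists>a\<in>S. dom a \<subseteq> U \<and> g \<in> unit_locus a"
    using bumpy assms unfolding bumpy_def urysohn_def unit_locus_def by blast
  then obtain a where "a \<in> bumps_at g" "dom a \<subseteq> U" unfolding bumps_at_def by blast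
  then show thesis using that[of a] bumps_atD[of a g] dom_open[of a] dom_carrier[of a] by simp
qed

lemma bump_at:
  assumes "g \<in> carrier G"
  obtains a where "a \<in> bumps_at g" "a \<in> S" "a \<in> A" "g \<in> dom a"
    "openin T (dom a)" "dom a \<subseteq> carrier G"
  using bump_below[of "carrier G" g] assms topspace openin_topspace[of T] by metis

text \<open>
  Involutivity is used in this form: elements of \<open>Z\<close> are diagonal, and the interior is represented
  by a neighbourhood \<open>V\<close> of \<open>g\<inverse>\<close>.
\<close>

lemma local_inverse:
  assumes "a \<in> bumps_at g"
  obtains b V where "b \<in> S" "openin T V" "ginv G g \<in> V" "m a b \<in> D" "m b a \<in> D"
    "\<And>h. h \<in> V \<Longrightarrow> h \<in> carrier G \<and> (\<exists>y\<in>Units Y. b h = Some y \<and> a (ginv G h) = Some (inv\<^bsub>Y\<^esub> y))"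
proof -
  let ?W = "\<lambda>b. {h \<in> carrier G. \<exists>y\<in>Units Y. b h = Some y \<and> a (ginv G h) = Some (inv\<^bsub>Y\<^esub> y)}"
  obtain b where b: "b \<in> S" "m a b \<in> Z_part G Y A" "m b a \<in> Z_part G Y A"
    "ginv G g \<in> T interior_of (?W b)"
    using bumpy assms unfolding bumpy_def Z_involutive_def bumps_at_def unit_locus_def by blast
  show thesis
  proof (rule that[of b "T interior_of (?W b)"])
    show "m a b \<in> D" "m b a \<in> D" using b by (auto simp: Z_part_def D_part_def)
    show "h \<in> carrier G \<and> (\<exists>y\<in>Units Y. b h = Some y \<and> a (ginv G h) = Some (inv\<^bsub>Y\<^esub> y))"
      if "h \<in> T interior_of (?W b)" for h
      using subsetD[OF interior_of_subset that] by simp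
  qed (use b in simp_all)
qed

section \<open>The groupoid is etale\<close>

lemma units_open: "openin T (gunits G)"
proof (subst openin_subopen, intro ballI)
  fix x assume x: "x \<in> gunits G"
  then have xc: "x \<in> carrier G" by (rule unit_closed)
  then obtain a where a: "a \<in> bumps_at x" "a \<in> A" "x \<in> dom a" by (rule bump_at)
  from a(1) obtain b V where b: "b \<in> S" "ginv G x \<in> V" "m a b \<in> D"
    "\<And>h. h \<in> V \<Longrightarrow> h \<in> carrier G \<and> (\<exists>y\<in>Units Y. b h = Some y \<and> a (ginv G h) = Some (inv\<^bsub>Y\<^esub> y))"
    by (rule local_inverse) blast
  \<comment> \<open>As \<open>x\<close> is its own inverse, it lies in both domains, hence in the domain of the diagonal \<open>a b\<close>.\<close>
  have xb: "x \<in> dom b" using b x unit_inv by fastforce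
  have "gmul G x x = x" using x xc mul_unit unit_src unit_rng by simp
  moreover have "gmul G x x \<in> gset_mul G (dom a) (dom b)"
    using a xb x unit_src unit_rng by (intro gset_mulI) auto
  ultimately have "x \<in> dom (m a b)" using dom_m[of a b] a b S_A by simp
  then show "\<exists>U. openin T U \<and> x \<in> U \<and> U \<subseteq> gunits G"
    using D_units[OF b(3)] dom_open[OF D_A[OF b(3)]] by blast
qed

text \<open>
  A local inverse \<open>b\<close> of \<open>a\<close> has \<open>a(h\<inverse>)\<close> defined for all \<open>h\<close> near \<open>g\<inverse>\<close>, which places a whole
  neighbourhood of \<open>g\<inverse>\<close> inside \<open>(dom a)\<inverse>\<close>.
\<close>

lemma inv_image_open:
  assumes "openin T U"
  shows "openin T (ginv G ` U)"
proof (subst openin_subopen, intro ballI)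
  fix x assume "x \<in> ginv G ` U"
  then obtain g where g: "g \<in> U" "x = ginv G g" by auto
  obtain a where a: "a \<in> bumps_at g" "dom a \<subseteq> U" using assms g(1) by (rule bump_below)
  from a(1) obtain b V where V: "openin T V" "ginv G g \<in> V"
    "\<And>h. h \<in> V \<Longrightarrow> h \<in> carrier G \<and> (\<exists>y\<in>Units Y. b h = Some y \<and> a (ginv G h) = Some (inv\<^bsub>Y\<^esub> y))"
    by (rule local_inverse) blast
  have "V \<subseteq> ginv G ` U"
  proof
    fix h assume "h \<in> V"
    then have "h \<in> carrier G" "ginv G h \<in> U" using V(3)[of h] a by auto
    then show "h \<in> ginv G ` U" using inv_inv by force
  qed
  then show "\<exists>V. openin T V \<and> x \<in> V \<and> V \<subseteq> ginv G ` U" using V g by blast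
qed

text \<open>
  The domain of a product of elements of \<open>S\<close> is the product of the domains, and it is open because
  \<open>A\<close> is closed under the product.
\<close>

lemma gset_mul_open:
  assumes "openin T U" "openin T V"
  shows "openin T (gset_mul G U V)"
proof (subst openin_subopen, intro ballI)
  fix x assume "x \<in> gset_mul G U V"
  then obtain g h where gh: "g \<in> U" "h \<in> V" "gsrc G g = grng G h" "x = gmul G g h"
    by (auto simp: gset_mul_def)
  obtain a where a: "dom a \<subseteq> U" "a \<in> S" "a \<in> A" "g \<in> dom a" using assms(1) gh(1) by (rule bump_below)
  obtain b where b: "dom b \<subseteq> V" "b \<in> A" "h \<in> dom b" using assms(2) gh(2) by (rule bump_below)
  have "dom (m a b) = gset_mul G (dom a) (dom b)" using a b dom_m by simp
  moreover have "openin T (dom (m a b))" using a b dom_open[OF m_closed] by simp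
  moreover have "x \<in> gset_mul G (dom a) (dom b)" using gh a b gset_mulI by simp
  moreover have "gset_mul G (dom a) (dom b) \<subseteq> gset_mul G U V"
    using a b unfolding gset_mul_def by blast
  ultimately show "\<exists>W. openin T W \<and> x \<in> W \<and> W \<subseteq> gset_mul G U V" by metis
qed

text \<open>
  Continuity of the source map is a case of openness of products: the preimage of a set of units
  is the product of the whole groupoid with this set.
\<close>

lemma src_preimage_open:
  assumes "openin T U"
  shows "openin T {g \<in> carrier G. gsrc G g \<in> U}"
proof -
  have "{g \<in> carrier G. gsrc G g \<in> U} = gset_mul G (carrier G) (U \<inter> gunits G)"
    using gset_mul_units_right[of "carrier G" "U \<inter> gunits G"] src_unit by auto
  then show ?thesis using gset_mul_open units_open assms topspace by (metis openin_Int openin_topspace)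
qed

lemma rng_preimage_open:
  assumes "openin T U"
  shows "openin T {g \<in> carrier G. grng G g \<in> U}"
proof -
  have "{g \<in> carrier G. grng G g \<in> U} = gset_mul G (U \<inter> gunits G) (carrier G)"
    using gset_mul_units_left[of "carrier G" "U \<inter> gunits G"] rng_unit by auto
  then show ?thesis using gset_mul_open units_open assms topspace by (metis openin_Int openin_topspace)
qed

text \<open>
  On a bisection \<open>B\<close> the set \<open>B\<inverse> B\<close> is the image of \<open>B\<close> under the source map.
\<close>

lemma src_image_open:
  assumes "openin T U"
  shows "openin T (gsrc G ` U)"
proof (subst openin_subopen, intro ballI)
  fix x assume "x \<in> gsrc G ` U"
  then obtain g where g: "g \<in> U" "x = gsrc G g" by auto
  have gc: "g \<in> carrier G" using g assms openin_subset topspace by blast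
  obtain a where a: "dom a \<subseteq> U" "a \<in> S" "g \<in> dom a" "openin T (dom a)" "dom a \<subseteq> carrier G"
    using assms g(1) by (rule bump_below)
  let ?W = "gset_mul G (ginv G ` dom a) (dom a)"
  have "openin T ?W" using gset_mul_open inv_image_open a by simp
  moreover have "x \<in> ?W"
    using g gc a gset_mulI[of "ginv G g" "ginv G ` dom a" g "dom a"] src_inv[of g] gsrc_def[of G g] by simp
  moreover have "?W \<subseteq> gsrc G ` U"
  proof
    fix w assume "w \<in> ?W"
    then obtain h k where hk: "h \<in> dom a" "k \<in> dom a" "gsrc G (ginv G h) = grng G k" "w = gmul G (ginv G h) k"
      by (auto simp: gset_mul_def)
    then have "grng G h = grng G k" using src_inv a by auto
    then have "h = k" using hk S_inj(2)[OF a(2)] by (auto dest: inj_onD)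
    then have "w = gsrc G k" using hk by (simp add: gsrc_def)
    then show "w \<in> gsrc G ` U" using hk a by blast
  qed
  ultimately show "\<exists>W. openin T W \<and> x \<in> W \<and> W \<subseteq> gsrc G ` U" by blast
qed

lemma rng_image_open:
  assumes "openin T U"
  shows "openin T (grng G ` U)"
proof -
  have "U \<subseteq> carrier G" using assms openin_subset topspace by blast
  then have "grng G ` U = gsrc G ` (ginv G ` U)" unfolding image_image using src_inv by (intro image_cong) auto
  then show ?thesis using src_image_open inv_image_open assms by simp
qed

text \<open>
  If \<open>B\<close> is an open bisection around \<open>g\<close> and \<open>B'\<close> is a neighbourhood of \<open>g h\<close> inside \<open>W\<close>, then
  \<open>B\<inverse> B'\<close> is a neighbourhood of \<open>h\<close> and \<open>B (B\<inverse> B') \<subseteq> B'\<close>.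
\<close>

lemma mult_continuous_at:
  assumes "openin T W" "g \<in> carrier G" "h \<in> carrier G" "gsrc G g = grng G h" "gmul G g h \<in> W"
  shows "\<exists>U V. openin T U \<and> openin T V \<and> g \<in> U \<and> h \<in> V \<and> gset_mul G U V \<subseteq> W"
proof -
  obtain a where a: "dom a \<subseteq> W" "a \<in> A" "gmul G g h \<in> dom a" "openin T (dom a)" "dom a \<subseteq> carrier G"
    using assms(1,5) by (rule bump_below)
  obtain b where b: "b \<in> S" "g \<in> dom b" "openin T (dom b)" "dom b \<subseteq> carrier G"
    using assms(2) by (rule bump_at)
  let ?V = "gset_mul G (ginv G ` dom b) (dom a)"
  have "openin T ?V" using gset_mul_open inv_image_open a b by simp
  moreover have "h \<in> ?V"
  proof -
    have "gmul G (ginv G g) (gmul G g h) = h" "gsrc G (ginv G g) = grng G (gmul G g h)"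
      using left_cancel rng_mul src_inv assms by auto
    then show ?thesis
      using a(3) b(2) gset_mulI[of "ginv G g" "ginv G ` dom b" "gmul G g h" "dom a"] by simp
  qed
  moreover have "gset_mul G (dom b) ?V \<subseteq> W"
  proof
    fix w assume "w \<in> gset_mul G (dom b) ?V"
    then obtain g1 k x where *: "g1 \<in> dom b" "k \<in> dom b" "x \<in> dom a" "gsrc G (ginv G k) = grng G x"
      "gsrc G g1 = grng G (gmul G (ginv G k) x)" "w = gmul G g1 (gmul G (ginv G k) x)"
      by (auto simp: gset_mul_def)
    have kc: "k \<in> carrier G" "x \<in> carrier G" "ginv G k \<in> carrier G" using * a b inv_closed by auto
    have "gsrc G g1 = gsrc G k" using * rng_mul[of "ginv G k" x] rng_inv kc by simp
    then have "g1 = k" using S_inj(1)[OF b(1)] * by (auto dest: inj_onD)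
    moreover have "gmul G k (gmul G (ginv G k) x) = x" using left_cancel[of "ginv G k" x] inv_inv kc * by simp
    ultimately show "w \<in> W" using * a by auto
  qed
  ultimately show ?thesis using b by blast
qed

theorem etale: "etale_groupoid G T"
proof -
  let ?C = "{(g, h). g \<in> carrier G \<and> h \<in> carrier G \<and> gsrc G g = grng G h}"
  have "continuous_map T T (ginv G)"
    unfolding continuous_map_eq_topcontinuous_at topcontinuous_at_def
  proof (intro ballI conjI allI impI)
    fix x V assume x: "x \<in> topspace T" and V: "openin T V \<and> ginv G x \<in> V"
    have "\<forall>y\<in>ginv G ` V. ginv G y \<in> V" using V inv_inv openin_subset topspace by fastforce
    moreover have "x \<in> ginv G ` V" using V x inv_inv topspace by force
    ultimately show "\<exists>U. openin T U \<and> x \<in> U \<and> (\<forall>y\<in>U. ginv G y \<in> V)"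
      using V inv_image_open by blast
  qed (use topspace inv_closed in auto)
  moreover have "continuous_map (subtopology (prod_topology T T) ?C) T (\<lambda>(g, h). gmul G g h)"
    unfolding continuous_map_eq_topcontinuous_at topcontinuous_at_def
  proof (intro ballI conjI allI impI)
    fix p W assume p: "p \<in> topspace (subtopology (prod_topology T T) ?C)"
      and W: "openin T W \<and> (case p of (g, h) \<Rightarrow> gmul G g h) \<in> W"
    obtain g h where gh: "p = (g, h)" "g \<in> carrier G" "h \<in> carrier G" "gsrc G g = grng G h"
      using p by auto
    obtain U V where UV: "openin T U" "openin T V" "g \<in> U" "h \<in> V" "gset_mul G U V \<subseteq> W"
      using mult_continuous_at gh W by fastforce
    have "openin (subtopology (prod_topology T T) ?C) (?C \<inter> U \<times> V)"
      using UV by (simp add: openin_subtopology_Int2 openin_prod_Times_iff)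
    moreover have "\<forall>q\<in>?C \<inter> U \<times> V. (case q of (g, h) \<Rightarrow> gmul G g h) \<in> W"
      using UV(5) by (auto simp: gset_mul_def)
    ultimately show "\<exists>U. openin (subtopology (prod_topology T T) ?C) U \<and> p \<in> U \<and>
        (\<forall>q\<in>U. (case q of (g, h) \<Rightarrow> gmul G g h) \<in> W)"
      using gh UV by (intro exI[of _ "?C \<inter> U \<times> V"]) auto
  qed (use topspace mul_closed in auto)
  moreover have "local_homeomorphism T (subtopology T (gsrc G ` carrier G)) (gsrc G)"
    unfolding local_homeomorphism_def
  proof (intro conjI ballI)
    have cont: "continuous_map T T (gsrc G)"
      using src_preimage_open topspace src_closed by (simp add: continuous_map)  blast
    have om: "open_map T T (gsrc G)" using src_image_open by (simp add: open_map_def)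
    show "gsrc G \<in> topspace T \<rightarrow> topspace (subtopology T (gsrc G ` carrier G))"
      using topspace src_closed by auto
    fix x assume "x \<in> topspace T"
    then have "x \<in> carrier G" using topspace by simp
    then obtain a where a: "a \<in> S" "x \<in> dom a" "openin T (dom a)" "dom a \<subseteq> carrier G"
      by (rule bump_at)
    let ?U = "dom a" and ?X = "subtopology T (gsrc G ` carrier G)"
    have U: "openin T ?U" "?U \<subseteq> carrier G" using a by simp_all
    have sub: "gsrc G ` ?U \<subseteq> gsrc G ` carrier G" using U by blast
    have top: "subtopology ?X (gsrc G ` ?U) = subtopology T (gsrc G ` ?U)"
      using sub by (simp add: subtopology_subtopology inf.absorb2)
    have "homeomorphic_map (subtopology T ?U) (subtopology T (gsrc G ` ?U)) (gsrc G)"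
    proof (rule bijective_open_imp_homeomorphic_map)
      show "continuous_map (subtopology T ?U) (subtopology T (gsrc G ` ?U)) (gsrc G)"
        using cont by (intro continuous_map_into_subtopology continuous_map_from_subtopology) auto
      show "open_map (subtopology T ?U) (subtopology T (gsrc G ` ?U)) (gsrc G)"
        using om U by (intro open_map_into_subtopology open_map_from_subtopology) auto
      show "gsrc G ` topspace (subtopology T ?U) = topspace (subtopology T (gsrc G ` ?U))"
        using U topspace src_closed by auto
      show "inj_on (gsrc G) (topspace (subtopology T ?U))"
        using S_inj(1)[OF a(1)] by (simp add: inj_on_def)
    qed
    moreover have "openin ?X (gsrc G ` ?U)"
      using U src_image_open sub by (metis inf.absorb2 openin_subtopology_Int2)
    ultimately show "\<exists>U. openin T U \<and> x \<in> U \<and> openin ?X (gsrc G ` U) \<and>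
        homeomorphic_map (subtopology T U) (subtopology ?X (gsrc G ` U)) (gsrc G)"
      using U top a(2) by metis
  qed
  moreover have "openin T (gsrc G ` carrier G)" using units_open by (simp add: gunits_def)
  ultimately show ?thesis
    unfolding etale_groupoid_def using topspace groupoid_axioms by blast
qed

lemma separate_units:
  assumes "x \<in> gunits G" "y \<in> gunits G" "x \<noteq> y"
  obtains U V where "openin T U" "openin T V" "U \<subseteq> gunits G" "V \<subseteq> gunits G"
    "x \<in> U" "y \<in> V" "U \<inter> V = {}"
proof -
  have "topspace (subtopology T (gunits G)) = gunits G"
    using topspace unit_closed by auto
  then obtain U V where "openin (subtopology T (gunits G)) U" "openin (subtopology T (gunits G)) V"
    "x \<in> U" "y \<in> V" "disjnt U V"
    using hausdorff assms unfolding Hausdorff_space_def by metis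
  then show thesis
    using that[of U V] openin_open_subtopology[OF units_open] by (auto simp: disjnt_def)
qed

text \<open>
  The groupoid need not be Hausdorff, but it is a T1 space: the units are separated, and so are the
  points of an open bisection, as the source map is injective there.
\<close>

lemma eq_if_in_all_neighbourhoods:
  assumes "g \<in> carrier G" "h \<in> carrier G" "\<And>U. \<lbrakk>openin T U; g \<in> U\<rbrakk> \<Longrightarrow> h \<in> U"
  shows "g = h"
proof -
  have "gsrc G g = gsrc G h"
  proof (rule ccontr)
    assume "gsrc G g \<noteq> gsrc G h"
    then obtain U V where "openin T U" "gsrc G g \<in> U" "gsrc G h \<in> V" "U \<inter> V = {}"
      using separate_units src_unit assms by metis
    then show False using assms(3)[OF src_preimage_open] assms by blast
  qed
  moreover obtain a where a: "a \<in> S" "g \<in> dom a" "openin T (dom a)"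
    using assms(1) by (rule bump_at)
  moreover have "h \<in> dom a" using assms(3) a by simp
  ultimately show ?thesis using S_inj(1)[OF a(1)] by (auto dest: inj_onD)
qed

end

section \<open>Bisections and domination in terms of the product\<close>

text \<open>
  With \<open>f u w = u a w\<close> this says that \<open>a\<close> has two arrows with a common source and different
  ranges: \<open>u\<close> and \<open>v\<close> cut out the two ranges, and \<open>d\<close> lives on the common sources. Containment of
  \<open>dom d\<close> in a set of sources is replaced by the condition that this set meets every nonempty
  \<open>dom (d e)\<close>, since only emptiness of products can be seen by an isomorphism. With
  \<open>f u w = w a u\<close> the roles of source and range are exchanged.
\<close>

definition separates ::
  "('g \<rightharpoonup> 'y) set \<Rightarrow> (('g \<rightharpoonup> 'y) \<Rightarrow> ('g \<rightharpoonup> 'y) \<Rightarrow> ('g \<rightharpoonup> 'y)) \<Rightarrow>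
   (('g \<rightharpoonup> 'y) \<Rightarrow> ('g \<rightharpoonup> 'y) \<Rightarrow> ('g \<rightharpoonup> 'y)) \<Rightarrow> bool" where
  "separates D m f \<longleftrightarrow> (\<exists>u\<in>D. \<exists>v\<in>D. \<exists>d\<in>D. m u v = Map.empty \<and> d \<noteq> Map.empty \<and>
     (\<forall>e\<in>D. m d e \<noteq> Map.empty \<longrightarrow> f u (m d e) \<noteq> Map.empty \<and> f v (m d e) \<noteq> Map.empty))"

text \<open>
  The element \<open>s\<close> plays the part of an inverse of \<open>b\<close> on the domain of \<open>a\<close>. The relation is
  expressed by the product, \<open>S\<close> and \<open>D\<close> alone, so it is transported by every isomorphism that
  respects these.
\<close>

definition dominated :: "'a set \<Rightarrow> ('a \<Rightarrow> 'a \<Rightarrow> 'a) \<Rightarrow> 'a set \<Rightarrow> 'a \<Rightarrow> 'a \<Rightarrow> bool" where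
  "dominated S m D a b \<longleftrightarrow> (\<exists>s\<in>S. m (m a s) b = a \<and> m (m b s) a = a \<and>
     m a s \<in> D \<and> m s b \<in> D \<and> m b s \<in> D)"

context bumpy_semigroup
begin

lemma dom_D_D: "\<lbrakk>d \<in> D; e \<in> D\<rbrakk> \<Longrightarrow> dom (m d e) = dom d \<inter> dom e"
  using dom_m_D[of d e] D_units[of d] D_A[of d] unit_src by auto

text \<open>
  The maps \<open>p\<close> and \<open>q\<close> stand for source and range in either order. If two points of \<open>W\<close> have the
  same \<open>p\<close> and different \<open>q\<close>, the Hausdorff property separates the latter by \<open>u\<close> and \<open>v\<close>, and \<open>d\<close> is a
  bump inside the open set of those units that are reached from both. Conversely, applying the
  condition to a bump \<open>e\<close> below the set reached through \<open>u\<close> produces a unit that is also reached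
  through \<open>v\<close>.
\<close>

lemma separates_iff:
  assumes W: "openin T W"
    and p_unit: "\<And>g. g \<in> carrier G \<Longrightarrow> p g \<in> gunits G"
    and q_unit: "\<And>g. g \<in> carrier G \<Longrightarrow> q g \<in> gunits G"
    and p_open: "\<And>U. openin T U \<Longrightarrow> openin T (p ` U)"
    and q_cont: "\<And>U. openin T U \<Longrightarrow> openin T {g \<in> carrier G. q g \<in> U}"
    and f: "\<And>u w. \<lbrakk>u \<in> D; w \<in> D\<rbrakk> \<Longrightarrow> f u w \<noteq> Map.empty \<longleftrightarrow> (\<exists>g\<in>W. q g \<in> dom u \<and> p g \<in> dom w)"
  shows "separates D m f \<longleftrightarrow> (\<exists>g\<in>W. \<exists>h\<in>W. p g = p h \<and> q g \<noteq> q h)"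
proof
  assume "separates D m f"
  then obtain u v d where D: "u \<in> D" "v \<in> D" "d \<in> D" and uv: "m u v = Map.empty" and d: "d \<noteq> Map.empty"
    and e: "\<And>e. \<lbrakk>e \<in> D; m d e \<noteq> Map.empty\<rbrakk> \<Longrightarrow> f u (m d e) \<noteq> Map.empty \<and> f v (m d e) \<noteq> Map.empty"
    unfolding separates_def by blast
  have "dom u \<inter> dom v = {}" using dom_D_D[OF D(1,2)] uv by simp
  \<comment> \<open>The choice \<open>e = d\<close> shows that \<open>d\<close> meets the set reached through \<open>u\<close> at all.\<close>
  have "m d d \<noteq> Map.empty" using dom_D_D[of d d] D d by (metis Int_absorb dom_eq_empty_conv)
  then obtain g where g: "g \<in> W" "q g \<in> dom u" "p g \<in> dom (m d d)"
    using e[of d] f[of u "m d d"] m_D_D[of d d] D by blast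
  let ?O = "p ` (W \<inter> {k \<in> carrier G. q k \<in> dom u}) \<inter> dom d"
  have "openin T ?O"
    using W p_open q_cont dom_open[OF D_A[OF D(1)]] dom_open[OF D_A[OF D(3)]] by (simp add: openin_Int)
  moreover have "p g \<in> ?O"
    using g W openin_subset[OF W] topspace dom_D_D[of d d] D by auto
  ultimately obtain b where b: "dom b \<subseteq> ?O" "b \<in> S" "p g \<in> dom b" by (rule bump_below)
  have "dom b \<subseteq> gunits G" using b(1) D_units[OF D(3)] by blast
  then have "b \<in> D" by (rule S_imp_D[OF b(2)])
  have "m d b \<noteq> Map.empty"
    using dom_D_D[OF D(3) \<open>b \<in> D\<close>] b(3) g(3) dom_D_D[OF D(3) D(3)] by auto
  then obtain h where h: "h \<in> W" "q h \<in> dom v" "p h \<in> dom (m d b)"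
    using e[OF \<open>b \<in> D\<close>] f[of v "m d b"] m_D_D[of d b] D \<open>b \<in> D\<close> by blast
  then have "p h \<in> ?O" using dom_D_D[OF D(3) \<open>b \<in> D\<close>] b by blast
  then obtain k where "k \<in> W" "q k \<in> dom u" "p k = p h" by force
  then show "\<exists>g\<in>W. \<exists>h\<in>W. p g = p h \<and> q g \<noteq> q h"
    using h \<open>dom u \<inter> dom v = {}\<close> by (intro bexI[of _ k] bexI[of _ h]) auto
next
  assume "\<exists>g\<in>W. \<exists>h\<in>W. p g = p h \<and> q g \<noteq> q h"
  then obtain g h where gh: "g \<in> W" "h \<in> W" "p g = p h" "q g \<noteq> q h" by blast
  have c: "g \<in> carrier G" "h \<in> carrier G" using gh openin_subset[OF W] topspace by auto
  obtain U V where UV: "openin T U" "openin T V" "U \<subseteq> gunits G" "V \<subseteq> gunits G"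
    "q g \<in> U" "q h \<in> V" "U \<inter> V = {}"
    using q_unit[OF c(1)] q_unit[OF c(2)] gh(4) by (rule separate_units)
  obtain u where u: "dom u \<subseteq> U" "u \<in> S" "q g \<in> dom u" "openin T (dom u)"
    using UV(1,5) by (rule bump_below)
  obtain v where v: "dom v \<subseteq> V" "v \<in> S" "q h \<in> dom v" "openin T (dom v)"
    using UV(2,6) by (rule bump_below)
  have uD: "u \<in> D" and vD: "v \<in> D" using u v UV S_imp_D by auto
  let ?P = "\<lambda>u. p ` (W \<inter> {k \<in> carrier G. q k \<in> dom u})"
  have "openin T (?P u \<inter> ?P v)" using W p_open q_cont u v by (simp add: openin_Int)
  moreover have "p g \<in> ?P u \<inter> ?P v"
    using gh u v c by (auto intro: image_eqI[of _ p g] image_eqI[of _ p h])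
  ultimately obtain d where d: "dom d \<subseteq> ?P u \<inter> ?P v" "d \<in> S" "p g \<in> dom d"
    by (rule bump_below)
  have "dom d \<subseteq> gunits G" using d(1) p_unit by blast
  then have dD: "d \<in> D" by (rule S_imp_D[OF d(2)])
  have "m u v = Map.empty" using dom_D_D[OF uD vD] u v UV by (metis Int_mono dom_eq_empty_conv subset_empty)
  moreover have "d \<noteq> Map.empty" using d by auto
  moreover have "f u (m d e) \<noteq> Map.empty \<and> f v (m d e) \<noteq> Map.empty"
    if e: "e \<in> D" "m d e \<noteq> Map.empty" for e
  proof -
    have "dom (m d e) \<noteq> {}" using e by simp
    then obtain x where x: "x \<in> dom (m d e)" by blast
    then have "x \<in> ?P u" "x \<in> ?P v" using dom_D_D[OF dD e(1)] d by auto
    obtain k where k: "k \<in> W" "q k \<in> dom u" "p k = x" using \<open>x \<in> ?P u\<close> by force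
    obtain l where l: "l \<in> W" "q l \<in> dom v" "p l = x" using \<open>x \<in> ?P v\<close> by force
    have "\<exists>g\<in>W. q g \<in> dom u \<and> p g \<in> dom (m d e)" using k x by metis
    moreover have "\<exists>g\<in>W. q g \<in> dom v \<and> p g \<in> dom (m d e)" using l x by metis
    ultimately show ?thesis using f[OF uD m_D_D[OF dD e(1)]] f[OF vD m_D_D[OF dD e(1)]] by simp
  qed
  ultimately show "separates D m f" unfolding separates_def using uD vD dD by blast
qed

text \<open>
  An isomorphism that respects \<open>D\<close> respects the right-hand side, hence \<open>S\<close>. The two conditions
  exclude two arrows of \<open>dom a\<close> with equal sources and different ranges, and conversely, which is
  what it means for \<open>a\<close> to belong to \<open>N = S\<close>.
\<close>

lemma S_iff:
  assumes a: "a \<in> A"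
  shows "a \<in> S \<longleftrightarrow> \<not> separates D m (\<lambda>u w. m u (m a w)) \<and> \<not> separates D m (\<lambda>u w. m (m w a) u)"
proof -
  have W: "openin T (dom a)" "dom a \<subseteq> carrier G" using a dom_open dom_carrier by auto
  have "m u (m a w) \<noteq> Map.empty \<longleftrightarrow> (\<exists>g\<in>dom a. grng G g \<in> dom u \<and> gsrc G g \<in> dom w)"
    if "u \<in> D" "w \<in> D" for u w
  proof -
    have "dom (m u (m a w)) = {g \<in> dom a. grng G g \<in> dom u \<and> gsrc G g \<in> dom w}"
      using dom_D_m[of "m a w" u] dom_m_D[of a w] m_closed a that D_A by auto
    then show ?thesis by (metis (mono_tags, lifting) dom_eq_empty_conv empty_Collect_eq)
  qed
  then have 1: "separates D m (\<lambda>u w. m u (m a w)) \<longleftrightarrow>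
      (\<exists>g\<in>dom a. \<exists>h\<in>dom a. gsrc G g = gsrc G h \<and> grng G g \<noteq> grng G h)"
    using W src_unit rng_unit src_image_open rng_preimage_open by (intro separates_iff) auto
  have "m (m w a) u \<noteq> Map.empty \<longleftrightarrow> (\<exists>g\<in>dom a. gsrc G g \<in> dom u \<and> grng G g \<in> dom w)"
    if "u \<in> D" "w \<in> D" for u w
  proof -
    have "dom (m (m w a) u) = {g \<in> dom a. gsrc G g \<in> dom u \<and> grng G g \<in> dom w}"
      using dom_m_D[of "m w a" u] dom_D_m[of a w] m_closed a that D_A by auto
    then show ?thesis by (metis (mono_tags, lifting) dom_eq_empty_conv empty_Collect_eq)
  qed
  then have 2: "separates D m (\<lambda>u w. m (m w a) u) \<longleftrightarrow>
      (\<exists>g\<in>dom a. \<exists>h\<in>dom a. grng G g = grng G h \<and> gsrc G g \<noteq> gsrc G h)"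
    using W src_unit rng_unit rng_image_open src_preimage_open by (intro separates_iff) auto
  have "a \<in> S \<longleftrightarrow> isosection G (dom a)" using S_eq_N a by (auto simp: N_part_def)
  then show ?thesis unfolding 1 2 isosection_iff using W by blast
qed

lemma cancel_one:
  assumes "x \<in> carrier Y" "y \<in> carrier Y"
  shows "x \<otimes>\<^bsub>Y\<^esub> y = x \<longleftrightarrow> y = \<one>\<^bsub>Y\<^esub>" "y \<otimes>\<^bsub>Y\<^esub> x = x \<longleftrightarrow> y = \<one>\<^bsub>Y\<^esub>"
  using Y_cancel assms unfolding one_cancellative_def by auto

text \<open>
  If a product of two elements of \<open>S\<close> is diagonal, the only composable pairs are those of mutually
  inverse arrows.
\<close>

lemma dom_m_D_imp:
  assumes "a \<in> S" "b \<in> S" "m a b \<in> D" "x \<in> dom (m a b)"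
  obtains g where "g \<in> dom b" "x = gsrc G g" "ginv G g \<in> dom a"
proof -
  obtain h g where hg: "h \<in> dom a" "g \<in> dom b" "gsrc G h = grng G g" "x = gmul G h g"
    using assms(4) dom_m[of a b] assms S_A by (auto simp: gset_mul_def)
  have c: "h \<in> carrier G" "g \<in> carrier G" using hg assms S_A dom_carrier by blast+
  have "gmul G h g \<in> gunits G" using hg assms D_units by blast
  then show thesis
    using that[of g] hg product_unit_imp_inverse[OF c] product_unit_eq_src[OF c] by simp
qed

text \<open>
  Comparing values in \<open>a (s b) = a\<close> and \<open>(b s) a = a\<close>, 1-cancellation gives \<open>s b = 1\<close> on the sources
  and \<open>b s = 1\<close> on the ranges of \<open>dom a\<close>. So \<open>s\<close> inverts \<open>b\<close> pointwise on \<open>dom a\<close>, and \<open>[1](s b)\<close> is the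
  compact set between the sources of the two domains.
\<close>

lemma dominatedD:
  assumes a: "a \<in> S" and b: "b \<in> S" and dom: "dominated S m D a b"
  shows "dom a \<subseteq> dom b" "\<And>g. g \<in> dom a \<Longrightarrow> \<exists>y\<in>Units Y. b g = Some y"
    "\<exists>K. compactin T K \<and> gsrc G ` dom a \<subseteq> K \<and> K \<subseteq> gsrc G ` dom b"
proof -
  obtain s where s: "s \<in> S" "m (m a s) b = a" "m (m b s) a = a" "m a s \<in> D" "m s b \<in> D" "m b s \<in> D"
    using dom unfolding dominated_def by blast
  have sA: "a \<in> A" "b \<in> A" "s \<in> A" using a b s S_A by auto
  have assoc: "m a (m s b) = a" using s m_assoc sA by simp
  let ?K = "level_set {\<one>\<^bsub>Y\<^esub>} (m s b)"
  have main: "g \<in> dom b \<and> gsrc G g \<in> ?K \<and> (\<exists>y\<in>Units Y. b g = Some y)" if g: "g \<in> dom a" for g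
  proof -
    have gc: "g \<in> carrier G" using g sA dom_carrier by blast
    obtain w where w: "a g = Some w" using g by auto
    have wY: "w \<in> carrier Y" using value_closed sA w by blast
    have gb: "g \<in> dom b" using dom_D_m[OF sA(2) s(4)] s(2) g by auto
    then obtain y where y: "b g = Some y" by auto
    have "gsrc G g \<in> dom (m s b)" using dom_m_D[OF sA(1) s(5)] assoc g by auto
    then obtain z where z: "m s b (gsrc G g) = Some z" by auto
    have "z \<in> carrier Y" using z value_closed D_A s by blast
    moreover have "w \<otimes>\<^bsub>Y\<^esub> z = w" using m_D_value[OF sA(1) s(5) w z] assoc w by simp
    ultimately have z1: "z = \<one>\<^bsub>Y\<^esub>" using cancel_one wY by blast
    \<comment> \<open>The unit \<open>g\<inverse> g\<close> is a product of arrows of \<open>s\<close> and \<open>b\<close>; injectivity of the source map on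
        \<open>dom b\<close> identifies the second one with \<open>g\<close>, which yields \<open>s(g\<inverse>)\<close>.\<close>
    obtain k where k: "k \<in> dom b" "gsrc G g = gsrc G k" "ginv G k \<in> dom s"
      using dom_m_D_imp[OF s(1) b s(5)] \<open>gsrc G g \<in> dom (m s b)\<close> by metis
    then have "k = g" using S_inj(1)[OF b] gb by (auto dest: inj_onD)
    then obtain t where t: "s (ginv G g) = Some t" using k by auto
    have "m s b (gsrc G g) = Some (t \<otimes>\<^bsub>Y\<^esub> y)"
      using m_value[of s b "ginv G g" t g y] sA s t y gc src_inv gsrc_def[of G g] by simp
    then have ty: "t \<otimes>\<^bsub>Y\<^esub> y = \<one>\<^bsub>Y\<^esub>" using z z1 by simp
    have "m b s (grng G g) = Some (y \<otimes>\<^bsub>Y\<^esub> t)"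
      using m_value[of b s g y "ginv G g" t] sA s t y gc rng_inv grng_def[of G g] by simp
    then have "a g = Some ((y \<otimes>\<^bsub>Y\<^esub> t) \<otimes>\<^bsub>Y\<^esub> w)"
      using D_m_value[OF sA(1) s(6) w] s(3) by simp
    then have "(y \<otimes>\<^bsub>Y\<^esub> t) \<otimes>\<^bsub>Y\<^esub> w = w" using w by simp
    moreover have yt: "y \<in> carrier Y" "t \<in> carrier Y" using y t value_closed sA by blast+
    ultimately have "y \<otimes>\<^bsub>Y\<^esub> t = \<one>\<^bsub>Y\<^esub>"
      using cancel_one(2)[OF wY] monoid.m_closed[OF Y_monoid] by blast
    then have "y \<in> Units Y" using ty yt unfolding Units_def by blast
    then show ?thesis using gb y z z1 by (auto simp: level_set_def)
  qed
  then show "dom a \<subseteq> dom b" "\<And>g. g \<in> dom a \<Longrightarrow> \<exists>y\<in>Units Y. b g = Some y" by blast+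
  have "compactin T ?K" using bumpy D_S[OF s(5)] unfolding bumpy_def one_proper_def by blast
  moreover have "?K \<subseteq> gsrc G ` dom b"
  proof
    fix x assume "x \<in> ?K"
    then have "x \<in> dom (m s b)" by (auto simp: level_set_def)
    then obtain k where "k \<in> dom b" "x = gsrc G k" using dom_m_D_imp[OF s(1) b s(5)] by metis
    then show "x \<in> gsrc G ` dom b" by blast
  qed
  ultimately show "\<exists>K. compactin T K \<and> gsrc G ` dom a \<subseteq> K \<and> K \<subseteq> gsrc G ` dom b"
    using main by (intro exI[of _ ?K]) auto
qed

text \<open>
  Where \<open>b(h\<inverse>)\<close> is the inverse of \<open>a(h)\<close>, the products \<open>a b\<close> and \<open>b a\<close> take the value 1, so \<open>b\<close>
  witnesses domination for every function supported there. This strengthening of the existence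
  of a single dominated function makes directedness immediate.
\<close>

lemma dominated_near:
  assumes "a \<in> bumps_at g"
  obtains U where "openin T U" "g \<in> U" "\<And>d. \<lbrakk>d \<in> S; dom d \<subseteq> U\<rbrakk> \<Longrightarrow> dominated S m D d a"
proof -
  obtain b V where b: "b \<in> S" "openin T V" "ginv G g \<in> V" "m a b \<in> D" "m b a \<in> D"
    and V: "\<And>h. h \<in> V \<Longrightarrow> h \<in> carrier G \<and> (\<exists>y\<in>Units Y. b h = Some y \<and> a (ginv G h) = Some (inv\<^bsub>Y\<^esub> y))"
    using assms by (rule local_inverse) blast
  note a = bumps_atD[OF assms]
  have bA: "b \<in> A" using b S_A by simp
  have gc: "g \<in> carrier G" using a dom_carrier by blast
  show thesis
  proof (rule that[of "ginv G ` V"])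
    show "openin T (ginv G ` V)" using inv_image_open b by simp
    show "g \<in> ginv G ` V" using image_eqI[of g "ginv G" "ginv G g" V] b inv_inv gc by simp
    fix d assume d: "d \<in> S" "dom d \<subseteq> ginv G ` V"
    have dA: "d \<in> A" using d S_A by simp
    have near: "k \<in> carrier G \<and> (\<exists>y\<in>Units Y. b (ginv G k) = Some y \<and> a k = Some (inv\<^bsub>Y\<^esub> y))"
      if k: "k \<in> dom d" for k
    proof -
      obtain h where h: "h \<in> V" "k = ginv G h" using d k by blast
      then show ?thesis using V[OF h(1)] inv_inv inv_closed by auto
    qed
    have "dom d \<subseteq> dom a" using near by blast
    then have "gset_mul G (dom d) (dom b) \<subseteq> gset_mul G (dom a) (dom b)"
      unfolding gset_mul_def by blast
    then have "dom (m d b) \<subseteq> dom (m a b)" using dom_m[of d b] dom_m[of a b] b(1) a bA dA by simp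
    then have db: "m d b \<in> D" using D_units[OF b(4)] m_S[OF d(1) b(1)] by (intro S_imp_D) auto
    have "m d (m b a) = d"
    proof
      fix k
      show "m d (m b a) k = d k"
      proof (cases "d k")
        case None
        then have "k \<notin> dom (m d (m b a))" using dom_m_D[OF dA b(5)] by (simp add: domIff)
        then show ?thesis using None by (simp add: domIff)
      next
        case (Some w)
        then have wY: "w \<in> carrier Y" using value_closed dA by blast
        obtain y where kc: "k \<in> carrier G"
          and y: "y \<in> Units Y" "b (ginv G k) = Some y" "a k = Some (inv\<^bsub>Y\<^esub> y)"
          using near[OF domI[of d, OF Some]] by blast
        have "m b a (gsrc G k) = Some (y \<otimes>\<^bsub>Y\<^esub> inv\<^bsub>Y\<^esub> y)"
          using m_value[of b a "ginv G k" y k "inv\<^bsub>Y\<^esub> y"] y bA a b kc src_inv gsrc_def[of G k] by simp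
        then have "m b a (gsrc G k) = Some \<one>\<^bsub>Y\<^esub>" using monoid.Units_r_inv[OF Y_monoid y(1)] by simp
        then show ?thesis
          using m_D_value[OF dA b(5) Some] monoid.r_one[OF Y_monoid wY] Some by simp
      qed
    qed
    moreover have "m (m a b) d = d"
    proof
      fix k
      show "m (m a b) d k = d k"
      proof (cases "d k")
        case None
        then have "k \<notin> dom (m (m a b) d)" using dom_D_m[OF dA b(4)] by (simp add: domIff)
        then show ?thesis using None by (simp add: domIff)
      next
        case (Some w)
        then have wY: "w \<in> carrier Y" using value_closed dA by blast
        obtain y where kc: "k \<in> carrier G"
          and y: "y \<in> Units Y" "b (ginv G k) = Some y" "a k = Some (inv\<^bsub>Y\<^esub> y)"
          using near[OF domI[of d, OF Some]] by blast
        have "m a b (grng G k) = Some (inv\<^bsub>Y\<^esub> y \<otimes>\<^bsub>Y\<^esub> y)"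
          using m_value[of a b k "inv\<^bsub>Y\<^esub> y" "ginv G k" y] y bA a b kc rng_inv grng_def[of G k] by simp
        then have "m a b (grng G k) = Some \<one>\<^bsub>Y\<^esub>" using monoid.Units_l_inv[OF Y_monoid y(1)] by simp
        then show ?thesis
          using D_m_value[OF dA b(4) Some] monoid.l_one[OF Y_monoid wY] Some by simp
      qed
    qed
    ultimately show "dominated S m D d a"
      unfolding dominated_def using m_assoc[OF dA bA a(2)] db b by (intro bexI[of _ b]) auto
  qed
qed

lemma bumps_at_directed:
  assumes "a \<in> bumps_at g" "b \<in> bumps_at g"
  obtains d where "d \<in> bumps_at g" "dominated S m D d a" "dominated S m D d b"
proof -
  obtain U where U: "openin T U" "g \<in> U" "\<And>d. \<lbrakk>d \<in> S; dom d \<subseteq> U\<rbrakk> \<Longrightarrow> dominated S m D d a"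
    using assms(1) by (rule dominated_near) blast
  obtain V where V: "openin T V" "g \<in> V" "\<And>d. \<lbrakk>d \<in> S; dom d \<subseteq> V\<rbrakk> \<Longrightarrow> dominated S m D d b"
    using assms(2) by (rule dominated_near) blast
  have "openin T (U \<inter> V)" "g \<in> U \<inter> V" using U V by auto
  then obtain d where "d \<in> bumps_at g" "dom d \<subseteq> U \<inter> V" "d \<in> S" by (rule bump_below)
  then show thesis using that[of d] U V by simp
qed

lemma bumps_at_m:
  assumes "a \<in> bumps_at g" "b \<in> bumps_at h" "gsrc G g = grng G h"
  shows "m a b \<in> bumps_at (gmul G g h)"
proof -
  note a = bumps_atD[OF assms(1)] and b = bumps_atD[OF assms(2)]
  have "gmul G g h \<in> unit_locus (m a b)"
  proof (rule unit_locusI)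
    show "openin T (gset_mul G (unit_locus a) (unit_locus b))"
      using gset_mul_open unit_locus_open by simp
    show "gmul G g h \<in> gset_mul G (unit_locus a) (unit_locus b)"
      using assms gset_mulI by (simp add: bumps_at_def)
    fix x assume "x \<in> gset_mul G (unit_locus a) (unit_locus b)"
    then obtain k l where kl: "k \<in> unit_locus a" "l \<in> unit_locus b" "gsrc G k = grng G l" "x = gmul G k l"
      by (auto simp: gset_mul_def)
    obtain y z where "y \<in> Units Y" "a k = Some y" "z \<in> Units Y" "b l = Some z"
      using unit_locus_value kl by metis
    then show "\<exists>y\<in>Units Y. m a b x = Some y"
      using m_value[of a b k y l z] a b kl monoid.Units_m_closed[OF Y_monoid, of y z] by auto
  qed
  then show ?thesis using m_S a b by (simp add: bumps_at_def)
qed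

text \<open>
  A bump at \<open>g\<close> can be chosen inside any neighbourhood of \<open>g\<close>, so the inclusion places \<open>h\<close> in all of
  them.
\<close>

lemma bumps_at_subset_imp_eq:
  assumes "g \<in> carrier G" "h \<in> carrier G" "bumps_at g \<subseteq> bumps_at h"
  shows "g = h"
proof (rule eq_if_in_all_neighbourhoods[OF assms(1,2)])
  fix U assume "openin T U" "g \<in> U"
  then obtain a where "a \<in> bumps_at g" "dom a \<subseteq> U" by (rule bump_below)
  then show "h \<in> U" using assms(3) bumps_atD(3) by blast
qed

end

section \<open>Transporting points along an isomorphism\<close>

lemma degree_eq:
  assumes "c0 constant_on dom a" "g \<in> dom a"
  shows "degree c0 a = c0 g"
proof -
  have "\<forall>x\<in>dom a. c0 x = c0 g" using assms unfolding constant_on_def by metis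
  then have "c0 ` dom a = {c0 g}" using assms(2) by blast
  then show ?thesis unfolding degree_def by simp
qed

locale diagonal_iso =
  L: bumpy_semigroup G T c Y A m + R: bumpy_semigroup G' T' c' Y' A' m'
  for G :: "'g groupoid_data" and T and c :: "'g \<Rightarrow> 'k" and Y :: "'y monoid" and A m
    and G' :: "'h groupoid_data" and T' and c' :: "'h \<Rightarrow> 'k" and Y' :: "'z monoid" and A' m' +
  fixes \<phi> :: "('g \<rightharpoonup> 'y) \<Rightarrow> ('h \<rightharpoonup> 'z)"
  assumes iso: "semigroup_iso A m A' m' \<phi>"
    and diagonal: "\<phi> ` D_part G A = D_part G' A'"
begin

lemma \<phi>_bij: "bij_betw \<phi> A A'"
  using iso by (simp add: semigroup_iso_def)

lemma \<phi>_inj: "inj_on \<phi> A"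
  using \<phi>_bij by (rule bij_betw_imp_inj_on)

lemma \<phi>_closed: "a \<in> A \<Longrightarrow> \<phi> a \<in> A'"
  using \<phi>_bij by (rule bij_betwE[THEN bspec])

lemma \<phi>_m: "\<lbrakk>a \<in> A; b \<in> A\<rbrakk> \<Longrightarrow> \<phi> (m a b) = m' (\<phi> a) (\<phi> b)"
  using iso by (simp add: semigroup_iso_def)

lemma \<phi>_D: "d \<in> L.D \<Longrightarrow> \<phi> d \<in> R.D"
  using diagonal by blast

lemma inverse: "diagonal_iso G' T' c' Y' A' m' G T c Y A m (inv_into A \<phi>)"
proof unfold_locales
  have surj: "\<phi> ` A = A'" using \<phi>_bij by (rule bij_betw_imp_surj_on)
  have "inv_into A \<phi> (m' a b) = m (inv_into A \<phi> a) (inv_into A \<phi> b)" if ab: "a \<in> A'" "b \<in> A'" for a b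
  proof -
    let ?a = "inv_into A \<phi> a" and ?b = "inv_into A \<phi> b"
    have "?a \<in> A" "?b \<in> A" using ab surj inv_into_into[of _ \<phi> A] by auto
    moreover from this have "\<phi> (m ?a ?b) = m' a b"
      using \<phi>_m ab surj by (simp add: f_inv_into_f)
    ultimately show ?thesis using inv_into_f_f[OF \<phi>_inj, of "m ?a ?b"] L.m_closed by simp
  qed
  then show "semigroup_iso A' m' A m (inv_into A \<phi>)"
    unfolding semigroup_iso_def using bij_betw_inv_into[OF \<phi>_bij] by blast
  show "inv_into A \<phi> ` D_part G' A' = D_part G A"
    unfolding diagonal[symmetric] using \<phi>_inj by (rule inv_into_image_cancel) (auto simp: L.D_A)
qed

lemma \<phi>_empty: "\<phi> Map.empty = Map.empty"
proof -
  have e: "Map.empty \<in> A" "Map.empty \<in> A'" using L.empty_D R.empty_D L.D_A R.D_A by auto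
  then obtain a where a: "a \<in> A" "\<phi> a = Map.empty"
    using \<phi>_bij by (metis bij_betw_imp_surj_on imageE)
  have "m Map.empty a = Map.empty"
    using L.dom_D_m[OF a(1) L.empty_D] by (metis (no_types, lifting) Collect_empty_eq dom_eq_empty_conv empty_iff)
  then have "\<phi> Map.empty = m' (\<phi> Map.empty) Map.empty" using \<phi>_m[OF e(1) a(1)] a by simp
  moreover have "m' (\<phi> Map.empty) Map.empty = Map.empty"
    using R.dom_m_D[OF \<phi>_closed[OF e(1)] R.empty_D]
    by (metis (no_types, lifting) Collect_empty_eq dom_eq_empty_conv empty_iff)
  ultimately show ?thesis by simp
qed

lemma \<phi>_eq_empty: "a \<in> A \<Longrightarrow> \<phi> a = Map.empty \<longleftrightarrow> a = Map.empty"
  using \<phi>_empty \<phi>_inj L.empty_D L.D_A by (metis inj_on_eq_iff)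

text \<open>
  The map \<open>\<phi>\<close> respects \<open>D\<close>, the product and emptiness, and \<open>separates\<close> mentions nothing else.
\<close>

lemma \<phi>_separates:
  assumes "\<And>u w. \<lbrakk>u \<in> L.D; w \<in> L.D\<rbrakk> \<Longrightarrow> f u w \<in> A \<and> \<phi> (f u w) = f' (\<phi> u) (\<phi> w)"
  shows "separates L.D m f \<longleftrightarrow> separates R.D m' f'"
proof -
  have eq: "m' (\<phi> u) (\<phi> v) = Map.empty \<longleftrightarrow> m u v = Map.empty" if "u \<in> L.D" "v \<in> L.D" for u v
    using that \<phi>_m[of u v] \<phi>_eq_empty[of "m u v"] L.D_A L.m_closed by simp
  have eqf: "f' (\<phi> u) (m' (\<phi> d) (\<phi> e)) = Map.empty \<longleftrightarrow> f u (m d e) = Map.empty"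
    if "u \<in> L.D" "d \<in> L.D" "e \<in> L.D" for u d e
    using that assms[of u "m d e"] L.m_D_D[of d e] \<phi>_m[of d e] \<phi>_eq_empty[of "f u (m d e)"] L.D_A by simp
  have eqd: "\<phi> d = Map.empty \<longleftrightarrow> d = Map.empty" if "d \<in> L.D" for d
    using that \<phi>_eq_empty L.D_A by simp
  show ?thesis
    unfolding separates_def diagonal[symmetric] by (simp add: eq eqf eqd cong: bex_cong ball_cong)
qed

lemma \<phi>_S: "a \<in> A \<Longrightarrow> \<phi> a \<in> R.S \<longleftrightarrow> a \<in> L.S"
proof -
  assume a: "a \<in> A"
  have "separates L.D m (\<lambda>u w. m u (m a w)) \<longleftrightarrow> separates R.D m' (\<lambda>u w. m' u (m' (\<phi> a) w))"
    using a \<phi>_m L.m_closed L.D_A by (intro \<phi>_separates) simp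
  moreover have "separates L.D m (\<lambda>u w. m (m w a) u) \<longleftrightarrow> separates R.D m' (\<lambda>u w. m' (m' w (\<phi> a)) u)"
    using a \<phi>_m L.m_closed L.D_A by (intro \<phi>_separates) simp
  ultimately show ?thesis using L.S_iff[OF a] R.S_iff[OF \<phi>_closed[OF a]] by simp
qed

lemma \<phi>_dominated:
  assumes "a \<in> A" "b \<in> A" "dominated L.S m L.D a b"
  shows "dominated R.S m' R.D (\<phi> a) (\<phi> b)"
proof -
  obtain s where s: "s \<in> L.S" "m (m a s) b = a" "m (m b s) a = a" "m a s \<in> L.D" "m s b \<in> L.D" "m b s \<in> L.D"
    using assms(3) unfolding dominated_def by blast
  have sA: "s \<in> A" using s L.S_A by simp
  have "m' (m' (\<phi> a) (\<phi> s)) (\<phi> b) = \<phi> a" "m' (m' (\<phi> b) (\<phi> s)) (\<phi> a) = \<phi> a"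
    using s(2,3) \<phi>_m sA assms(1,2) L.m_closed by metis+
  moreover have "m' (\<phi> a) (\<phi> s) \<in> R.D" "m' (\<phi> s) (\<phi> b) \<in> R.D" "m' (\<phi> b) (\<phi> s) \<in> R.D"
    using s(4-6) \<phi>_D \<phi>_m sA assms(1,2) by metis+
  ultimately show ?thesis unfolding dominated_def using \<phi>_S[OF sA] s(1) by blast
qed

lemma \<phi>_dominatedD:
  assumes "a \<in> L.S" "b \<in> L.S" "dominated L.S m L.D a b"
  shows "dom (\<phi> a) \<subseteq> dom (\<phi> b)" "dom (\<phi> a) \<subseteq> R.unit_locus (\<phi> b)"
    "\<exists>K. compactin T' K \<and> gsrc G' ` dom (\<phi> a) \<subseteq> K \<and> K \<subseteq> gsrc G' ` dom (\<phi> b)"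
proof -
  have A: "a \<in> A" "b \<in> A" using assms L.S_A by auto
  have S: "\<phi> a \<in> R.S" "\<phi> b \<in> R.S" using assms \<phi>_S A by auto
  note R.dominatedD[OF S \<phi>_dominated[OF A assms(3)]]
  then show "dom (\<phi> a) \<subseteq> dom (\<phi> b)"
    "\<exists>K. compactin T' K \<and> gsrc G' ` dom (\<phi> a) \<subseteq> K \<and> K \<subseteq> gsrc G' ` dom (\<phi> b)" by auto
  show "dom (\<phi> a) \<subseteq> R.unit_locus (\<phi> b)"
    using R.dominatedD(2)[OF S \<phi>_dominated[OF A assms(3)]] R.dom_open[OF \<phi>_closed[OF A(1)]]
    by (intro subsetI R.unit_locusI[of "dom (\<phi> a)"])
qed

text \<open>
  Domination at \<open>g\<close> is transported by \<open>\<phi>\<close>, so the sets of sources of the functions \<open>\<phi> b\<close> are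
  nonempty, directed, and interlaced with compact sets of units. Compactness provides a common
  point. The argument is carried out in the unit space because the latter is Hausdorff, which
  makes compact sets closed.
\<close>

lemma transported_source:
  assumes g: "g \<in> carrier G"
  obtains x where "\<And>b. b \<in> L.bumps_at g \<Longrightarrow> x \<in> gsrc G' ` dom (\<phi> b)"
proof -
  let ?X = "subtopology T' (gunits G')"
  define \<K> where "\<K> = {K. compactin ?X K \<and> (\<exists>b\<in>L.bumps_at g. gsrc G' ` dom (\<phi> b) \<subseteq> K)}"
  have between: "\<exists>K\<in>\<K>. K \<subseteq> gsrc G' ` dom (\<phi> b)" if b: "b \<in> L.bumps_at g" for b
  proof -
    obtain d where d: "d \<in> L.bumps_at g" "dominated L.S m L.D d b"
      using b b by (rule L.bumps_at_directed)
    obtain K where K: "compactin T' K" "gsrc G' ` dom (\<phi> d) \<subseteq> K" "K \<subseteq> gsrc G' ` dom (\<phi> b)"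
      using \<phi>_dominatedD(3)[OF L.bumps_atD(1)[OF d(1)] L.bumps_atD(1)[OF b] d(2)] by blast
    have "dom (\<phi> b) \<subseteq> carrier G'" using R.dom_carrier \<phi>_closed L.bumps_atD(2)[OF b] by simp
    then have "K \<subseteq> gunits G'" using K(3) R.src_unit by blast
    then have "K \<in> \<K>" using K d unfolding \<K>_def by (auto simp: compactin_subtopology)
    then show ?thesis using K by blast
  qed
  have fip: "\<exists>d\<in>L.bumps_at g. \<forall>K\<in>F. gsrc G' ` dom (\<phi> d) \<subseteq> K" if "finite F" "F \<subseteq> \<K>" for F
    using that
  proof (induction F rule: finite_induct)
    case empty
    obtain a where "a \<in> L.bumps_at g" using g by (rule L.bump_at)
    then show ?case by blast
  next
    case (insert K F)
    then obtain d where d: "d \<in> L.bumps_at g" "\<forall>K\<in>F. gsrc G' ` dom (\<phi> d) \<subseteq> K" by auto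
    obtain b where b: "b \<in> L.bumps_at g" "gsrc G' ` dom (\<phi> b) \<subseteq> K"
      using insert.prems unfolding \<K>_def by auto
    obtain e where e: "e \<in> L.bumps_at g" "dominated L.S m L.D e d" "dominated L.S m L.D e b"
      using d(1) b(1) by (rule L.bumps_at_directed)
    have "dom (\<phi> e) \<subseteq> dom (\<phi> d)" "dom (\<phi> e) \<subseteq> dom (\<phi> b)"
      using \<phi>_dominatedD(1) L.bumps_atD(1) e b d by simp_all
    then have "gsrc G' ` dom (\<phi> e) \<subseteq> gsrc G' ` dom (\<phi> d)" "gsrc G' ` dom (\<phi> e) \<subseteq> gsrc G' ` dom (\<phi> b)"
      by (simp_all add: image_mono)
    then have "\<forall>C\<in>insert K F. gsrc G' ` dom (\<phi> e) \<subseteq> C" using b(2) d(2) by blast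
    then show ?case using e(1) by blast
  qed
  have nonempty: "dom (\<phi> d) \<noteq> {}" if "d \<in> L.bumps_at g" for d
    using \<phi>_eq_empty[OF L.bumps_atD(2)[OF that]] L.bumps_atD(3)[OF that] by auto
  obtain a where "a \<in> L.bumps_at g" using g by (rule L.bump_at)
  then obtain K0 where K0: "K0 \<in> \<K>" using between by blast
  have "K0 \<inter> \<Inter>\<K> \<noteq> {}"
  proof -
    have "compactin ?X K0" using K0 by (simp add: \<K>_def)
    then have "(\<forall>C\<in>\<K>. closedin ?X C) \<and> (\<forall>F. finite F \<and> F \<subseteq> \<K> \<longrightarrow> K0 \<inter> \<Inter>F \<noteq> {}) \<longrightarrow>
        K0 \<inter> \<Inter>\<K> \<noteq> {}"
      unfolding compactin_fip by (elim conjE) (erule spec)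
    moreover have "\<forall>C\<in>\<K>. closedin ?X C"
      using compactin_imp_closedin[OF R.hausdorff] by (simp add: \<K>_def)
    moreover have "K0 \<inter> \<Inter>F \<noteq> {}" if F: "finite F" "F \<subseteq> \<K>" for F
    proof -
      obtain d where d: "d \<in> L.bumps_at g" "\<forall>K\<in>insert K0 F. gsrc G' ` dom (\<phi> d) \<subseteq> K"
        using fip[of "insert K0 F"] F K0 by auto
      then have "gsrc G' ` dom (\<phi> d) \<subseteq> K0 \<inter> \<Inter>F" by blast
      then show ?thesis using nonempty[OF d(1)] by blast
    qed
    ultimately show ?thesis by simp
  qed
  then obtain x where x: "\<And>K. K \<in> \<K> \<Longrightarrow> x \<in> K" by blast
  show thesis
  proof (rule that[of x])
    fix b assume "b \<in> L.bumps_at g"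
    then show "x \<in> gsrc G' ` dom (\<phi> b)" using between x by blast
  qed
qed

text \<open>
  Above the common source \<open>x\<close> each bisection \<open>dom (\<phi> b)\<close> has exactly one arrow. By directedness
  these arrows all coincide.
\<close>

lemma transported_point:
  assumes g: "g \<in> carrier G"
  obtains g' where "g' \<in> carrier G'" "\<phi> ` L.bumps_at g \<subseteq> R.bumps_at g'"
proof -
  obtain x where x: "\<And>b. b \<in> L.bumps_at g \<Longrightarrow> x \<in> gsrc G' ` dom (\<phi> b)"
    using g by (rule transported_source) blast
  obtain a where a: "a \<in> L.bumps_at g" using g by (rule L.bump_at)
  then obtain g' where g': "g' \<in> dom (\<phi> a)" "x = gsrc G' g'" using x by blast
  have aS: "\<phi> a \<in> R.S" using \<phi>_S L.bumps_atD[OF a] by simp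
  have "\<phi> b \<in> R.bumps_at g'" if b: "b \<in> L.bumps_at g" for b
  proof -
    obtain d where d: "d \<in> L.bumps_at g" "dominated L.S m L.D d a" "dominated L.S m L.D d b"
      using a b by (rule L.bumps_at_directed)
    note S = L.bumps_atD(1)[OF a] L.bumps_atD(1)[OF b] L.bumps_atD(1)[OF d(1)]
    obtain k where k: "k \<in> dom (\<phi> d)" "x = gsrc G' k" using x[OF d(1)] by blast
    have "k \<in> dom (\<phi> a)" using \<phi>_dominatedD(1)[OF S(3,1) d(2)] k by blast
    then have "k = g'" using R.S_inj(1)[OF aS] k g' by (auto dest: inj_onD)
    then have "g' \<in> R.unit_locus (\<phi> b)" using \<phi>_dominatedD(2)[OF S(3,2) d(3)] k by blast
    then show ?thesis using \<phi>_S L.bumps_atD[OF b] by (simp add: R.bumps_at_def)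
  qed
  moreover have "g' \<in> carrier G'" using g' R.dom_carrier \<phi>_closed L.bumps_atD(2)[OF a] by blast
  ultimately show thesis using that by blast
qed

text \<open>
  Going forth along \<open>\<phi>\<close> and back along its inverse leads from the bumps at \<open>g\<close> into the bumps at some
  \<open>h\<close>, which forces \<open>h = g\<close> and turns both inclusions into equalities.
\<close>

lemma point_correspondence:
  assumes g: "g \<in> carrier G"
  obtains g' where "g' \<in> carrier G'" "\<phi> ` L.bumps_at g = R.bumps_at g'"
proof -
  interpret inverse: diagonal_iso G' T' c' Y' A' m' G T c Y A m "inv_into A \<phi>"
    by (rule inverse)
  obtain g' where g': "g' \<in> carrier G'" "\<phi> ` L.bumps_at g \<subseteq> R.bumps_at g'"
    using g by (rule transported_point)
  obtain h where h: "h \<in> carrier G" "inv_into A \<phi> ` R.bumps_at g' \<subseteq> L.bumps_at h"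
    using g'(1) by (rule inverse.transported_point)
  have sub: "L.bumps_at g \<subseteq> A" using L.bumps_atD(2) by blast
  have "inv_into A \<phi> ` (\<phi> ` L.bumps_at g) = L.bumps_at g"
    using \<phi>_inj sub by (rule inv_into_image_cancel)
  then have "L.bumps_at g \<subseteq> L.bumps_at h" using image_mono[OF g'(2), of "inv_into A \<phi>"] h(2) by simp
  then have "g = h" using L.bumps_at_subset_imp_eq g h by blast
  have "R.bumps_at g' \<subseteq> \<phi> ` L.bumps_at g"
  proof
    fix a assume a: "a \<in> R.bumps_at g'"
    then have "inv_into A \<phi> a \<in> L.bumps_at g" using h(2) \<open>g = h\<close> by blast
    moreover have "\<phi> (inv_into A \<phi> a) = a"
      using R.bumps_atD(2)[OF a] \<phi>_bij by (simp add: bij_betw_imp_surj_on f_inv_into_f)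
    ultimately show "a \<in> \<phi> ` L.bumps_at g" by (metis imageI)
  qed
  then show thesis using that[of g'] g' by blast
qed

definition \<psi> :: "'g \<Rightarrow> 'h" where
  "\<psi> g = (SOME g'. g' \<in> carrier G' \<and> \<phi> ` L.bumps_at g = R.bumps_at g')"

lemma
  assumes "g \<in> carrier G"
  shows \<psi>_closed: "\<psi> g \<in> carrier G'" and \<phi>_image_bumps_at: "\<phi> ` L.bumps_at g = R.bumps_at (\<psi> g)"
proof -
  have "\<exists>g'. g' \<in> carrier G' \<and> \<phi> ` L.bumps_at g = R.bumps_at g'"
    using point_correspondence[OF assms] by blast
  then have "\<psi> g \<in> carrier G' \<and> \<phi> ` L.bumps_at g = R.bumps_at (\<psi> g)"
    unfolding \<psi>_def by (rule someI_ex)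
  then show "\<psi> g \<in> carrier G'" "\<phi> ` L.bumps_at g = R.bumps_at (\<psi> g)" by auto
qed

lemma bumps_at_\<psi>:
  assumes "g \<in> carrier G" "a \<in> A"
  shows "\<phi> a \<in> R.bumps_at (\<psi> g) \<longleftrightarrow> a \<in> L.bumps_at g"
proof -
  have "L.bumps_at g \<subseteq> A" using L.bumps_atD(2) by blast
  then show ?thesis using \<phi>_image_bumps_at[OF assms(1)] \<phi>_inj assms(2) by (metis inj_on_image_mem_iff)
qed

lemma \<psi>_bij: "bij_betw \<psi> (carrier G) (carrier G')"
proof (rule bij_betw_imageI)
  show "inj_on \<psi> (carrier G)"
  proof (rule inj_onI)
    fix g h assume gh: "g \<in> carrier G" "h \<in> carrier G" "\<psi> g = \<psi> h"
    have "L.bumps_at g \<subseteq> L.bumps_at h"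
    proof
      fix a assume a: "a \<in> L.bumps_at g"
      then show "a \<in> L.bumps_at h" using bumps_at_\<psi>[of _ a] gh L.bumps_atD(2)[OF a] by metis
    qed
    then show "g = h" using L.bumps_at_subset_imp_eq gh by blast
  qed
  show "\<psi> ` carrier G = carrier G'"
  proof (intro equalityI subsetI)
    fix g' assume "g' \<in> \<psi> ` carrier G" then show "g' \<in> carrier G'" using \<psi>_closed by blast
  next
    interpret inverse: diagonal_iso G' T' c' Y' A' m' G T c Y A m "inv_into A \<phi>"
      by (rule inverse)
    fix g' assume g': "g' \<in> carrier G'"
    obtain g where g: "g \<in> carrier G" "inv_into A \<phi> ` R.bumps_at g' = L.bumps_at g"
      using g' by (rule inverse.point_correspondence)
    have "\<phi> ` (inv_into A \<phi> ` R.bumps_at g') = R.bumps_at g'"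
      using \<phi>_bij R.bumps_atD(2)
      by (intro image_inv_into_cancel[of \<phi> A A']) (auto simp: bij_betw_imp_surj_on)
    then have "R.bumps_at g' = R.bumps_at (\<psi> g)" using g \<phi>_image_bumps_at by simp
    then have "g' = \<psi> g" using R.bumps_at_subset_imp_eq g' \<psi>_closed[OF g(1)] by blast
    then show "g' \<in> \<psi> ` carrier G" using g by blast
  qed
qed

lemma \<psi>_mul_bumps:
  assumes "g \<in> carrier G" "h \<in> carrier G" "gsrc G g = grng G h"
    and "a \<in> R.bumps_at (\<psi> g)" "b \<in> R.bumps_at (\<psi> h)"
  shows "\<psi> (gmul G g h) \<in> dom (m' a b)"
proof -
  obtain a0 where a0: "a0 \<in> L.bumps_at g" "a = \<phi> a0" using \<phi>_image_bumps_at[OF assms(1)] assms(4) by blast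
  obtain b0 where b0: "b0 \<in> L.bumps_at h" "b = \<phi> b0" using \<phi>_image_bumps_at[OF assms(2)] assms(5) by blast
  have "m a0 b0 \<in> L.bumps_at (gmul G g h)" using a0 b0 L.bumps_at_m assms by simp
  then have "\<phi> (m a0 b0) \<in> R.bumps_at (\<psi> (gmul G g h))"
    using \<phi>_image_bumps_at[OF L.mul_closed[OF assms(1-3)]] by blast
  then show ?thesis using R.bumps_atD(3) \<phi>_m L.bumps_atD(2) a0 b0 by metis
qed

text \<open>
  Otherwise bumps at the two image points could be chosen with empty product, but the product of
  bumps at \<open>g\<close> and \<open>h\<close> is a bump at \<open>g h\<close>.
\<close>

lemma \<psi>_composable:
  assumes "g \<in> carrier G" "h \<in> carrier G" "gsrc G g = grng G h"
  shows "gsrc G' (\<psi> g) = grng G' (\<psi> h)"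
proof (rule ccontr)
  assume "gsrc G' (\<psi> g) \<noteq> grng G' (\<psi> h)"
  then obtain U V where UV: "openin T' U" "openin T' V" "gsrc G' (\<psi> g) \<in> U" "grng G' (\<psi> h) \<in> V" "U \<inter> V = {}"
    using R.separate_units[OF R.src_unit R.rng_unit] \<psi>_closed assms by metis
  have "\<psi> g \<in> {k \<in> carrier G'. gsrc G' k \<in> U}" "\<psi> h \<in> {k \<in> carrier G'. grng G' k \<in> V}"
    using UV \<psi>_closed assms by auto
  note nbhd = R.src_preimage_open[OF UV(1)] this(1) R.rng_preimage_open[OF UV(2)] this(2)
  obtain a where a: "a \<in> R.bumps_at (\<psi> g)" "dom a \<subseteq> {k \<in> carrier G'. gsrc G' k \<in> U}" "a \<in> R.S" "a \<in> A'"
    using nbhd(1,2) by (rule R.bump_below)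
  obtain b where b: "b \<in> R.bumps_at (\<psi> h)" "dom b \<subseteq> {k \<in> carrier G'. grng G' k \<in> V}" "b \<in> A'"
    using nbhd(3,4) by (rule R.bump_below)
  have "gsrc G' k \<noteq> grng G' l" if "k \<in> dom a" "l \<in> dom b" for k l
  proof -
    have "gsrc G' k \<in> U" "grng G' l \<in> V" using that a(2) b(2) by blast+
    then show ?thesis using UV(5) by auto
  qed
  then have "gset_mul G' (dom a) (dom b) = {}" unfolding gset_mul_def by blast
  then show False using R.dom_m[of a b] a b \<psi>_mul_bumps[OF assms a(1) b(1)] by simp
qed

text \<open>
  The products of bumps at \<open>\<psi> g\<close> and \<open>\<psi> h\<close> have arbitrarily small domains around \<open>\<psi> g \<cdot> \<psi> h\<close>, and
  all these domains contain \<open>\<psi> (g h)\<close>.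
\<close>

lemma \<psi>_mul:
  assumes "g \<in> carrier G" "h \<in> carrier G" "gsrc G g = grng G h"
  shows "\<psi> (gmul G g h) = gmul G' (\<psi> g) (\<psi> h)"
proof -
  have c: "\<psi> g \<in> carrier G'" "\<psi> h \<in> carrier G'" "gsrc G' (\<psi> g) = grng G' (\<psi> h)"
    using \<psi>_closed \<psi>_composable assms by auto
  have "gmul G' (\<psi> g) (\<psi> h) = \<psi> (gmul G g h)"
  proof (rule R.eq_if_in_all_neighbourhoods)
    show "gmul G' (\<psi> g) (\<psi> h) \<in> carrier G'" using R.mul_closed c by simp
    show "\<psi> (gmul G g h) \<in> carrier G'" using \<psi>_closed L.mul_closed assms by simp
    fix W assume W: "openin T' W" "gmul G' (\<psi> g) (\<psi> h) \<in> W"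
    obtain U V where UV: "openin T' U" "openin T' V" "\<psi> g \<in> U" "\<psi> h \<in> V" "gset_mul G' U V \<subseteq> W"
      using R.mult_continuous_at[OF W(1) c W(2)] by blast
    obtain a where a: "a \<in> R.bumps_at (\<psi> g)" "dom a \<subseteq> U" "a \<in> R.S" "a \<in> A'"
      using UV(1,3) by (rule R.bump_below)
    obtain b where b: "b \<in> R.bumps_at (\<psi> h)" "dom b \<subseteq> V" "b \<in> A'"
      using UV(2,4) by (rule R.bump_below)
    have "dom (m' a b) \<subseteq> gset_mul G' U V"
      using R.dom_m[of a b] a b unfolding gset_mul_def by blast
    then show "\<psi> (gmul G g h) \<in> W" using \<psi>_mul_bumps[OF assms a(1) b(1)] UV by blast
  qed
  then show ?thesis by simp
qed

lemma \<psi>_groupoid_iso: "groupoid_iso G G' \<psi>"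
  unfolding groupoid_iso_def using \<psi>_bij \<psi>_composable \<psi>_mul by blast

text \<open>
  Since \<open>\<psi>\<close> matches the points that have \<open>a\<close> among their bumps with those that have \<open>\<phi> a\<close>, it matches
  the bases formed by the sets \<open>unit_locus a\<close>.
\<close>

lemma \<psi>_homeomorphic: "homeomorphic_map T T' \<psi>"
proof (rule bijective_open_imp_homeomorphic_map)
  show "continuous_map T T' \<psi>"
    unfolding continuous_map_eq_topcontinuous_at topcontinuous_at_def
  proof (intro ballI conjI allI impI)
    fix g V assume "g \<in> topspace T" and V: "openin T' V \<and> \<psi> g \<in> V"
    then have g: "g \<in> carrier G" using L.topspace by simp
    obtain a' where a': "a' \<in> R.bumps_at (\<psi> g)" "dom a' \<subseteq> V" using V R.bump_below by metis
    obtain a where a: "a \<in> L.bumps_at g" "a' = \<phi> a" using \<phi>_image_bumps_at[OF g] a'(1) by blast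
    have "\<psi> k \<in> V" if k: "k \<in> L.unit_locus a" for k
    proof -
      have "k \<in> carrier G" using L.unit_locus_dom[OF k] L.dom_carrier L.bumps_atD(2)[OF a(1)] by blast
      moreover have "a \<in> L.bumps_at k" using k L.bumps_atD(1)[OF a(1)] by (simp add: L.bumps_at_def)
      ultimately have "a' \<in> R.bumps_at (\<psi> k)" using bumps_at_\<psi> a L.bumps_atD(2)[OF a(1)] by simp
      then show ?thesis using R.bumps_atD(3)[of a' "\<psi> k"] a'(2) by blast
    qed
    then show "\<exists>U. openin T U \<and> g \<in> U \<and> (\<forall>k\<in>U. \<psi> k \<in> V)"
      using L.unit_locus_open[of a] a(1) unfolding L.bumps_at_def by blast
  qed (use \<psi>_closed L.topspace R.topspace in auto)
  show "open_map T T' \<psi>"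
    unfolding open_map_def
  proof (intro allI impI)
    fix U assume U: "openin T U"
    show "openin T' (\<psi> ` U)"
    proof (subst openin_subopen, intro ballI)
      fix g' assume "g' \<in> \<psi> ` U"
      then obtain g where g: "g \<in> U" "g' = \<psi> g" by blast
      have gc: "g \<in> carrier G" using g U openin_subset L.topspace by blast
      obtain a where a: "a \<in> L.bumps_at g" "dom a \<subseteq> U" "a \<in> A" "dom a \<subseteq> carrier G"
        using U g(1) by (rule L.bump_below)
      have a': "\<phi> a \<in> R.bumps_at g'" using bumps_at_\<psi>[OF gc a(3)] a(1) g by simp
      have "R.unit_locus (\<phi> a) \<subseteq> \<psi> ` U"
      proof
        fix k' assume k': "k' \<in> R.unit_locus (\<phi> a)"
        then have "k' \<in> carrier G'"
          using R.unit_locus_dom[OF k'] R.dom_carrier[OF \<phi>_closed[OF a(3)]] by blast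
        then obtain k where k: "k \<in> carrier G" "k' = \<psi> k"
          using \<psi>_bij by (metis bij_betw_imp_surj_on imageE)
        have "\<phi> a \<in> R.bumps_at (\<psi> k)"
          using k' k R.bumps_atD(1)[OF a'] by (simp add: R.bumps_at_def)
        then have "k \<in> dom a" using bumps_at_\<psi>[OF k(1) a(3)] L.bumps_atD(3) by blast
        then show "k' \<in> \<psi> ` U" using a(2) k(2) by blast
      qed
      then show "\<exists>V. openin T' V \<and> g' \<in> V \<and> V \<subseteq> \<psi> ` U"
        using R.unit_locus_open[of "\<phi> a"] a' unfolding R.bumps_at_def by blast
    qed
  qed
  show "\<psi> ` topspace T = topspace T'" "inj_on \<psi> (topspace T)"
    using \<psi>_bij L.topspace R.topspace by (auto simp: bij_betw_def)
qed

lemma \<psi>_graded: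
  assumes "graded_map c c' A \<phi>" "g \<in> carrier G"
  shows "c' (\<psi> g) = c g"
proof -
  obtain a where a: "a \<in> L.bumps_at g" "a \<in> A" "g \<in> dom a" using assms(2) by (rule L.bump_at)
  have "\<psi> g \<in> dom (\<phi> a)" using bumps_at_\<psi>[OF assms(2) a(2)] a(1) R.bumps_atD(3) by blast
  then have "degree c' (\<phi> a) = c' (\<psi> g)" using degree_eq R.dom_homogeneous \<phi>_closed a(2) by metis
  moreover have "degree c a = c g" using degree_eq L.dom_homogeneous a by metis
  moreover have "degree c a = degree c' (\<phi> a)" using assms(1) a unfolding graded_map_def by auto
  ultimately show ?thesis by simp
qed

end

theorem corollary9p5:
  fixes G :: "'g groupoid_data" and G' :: "'h groupoid_data" and \<Gamma> :: "'k groupoid_data"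
    and T :: "'g topology" and T' :: "'h topology"
    and c :: "'g \<Rightarrow> 'k" and c' :: "'h \<Rightarrow> 'k"
    and Y :: "'y monoid" and Y' :: "'z monoid"
    and A :: "('g \<rightharpoonup> 'y) set" and A' :: "('h \<rightharpoonup> 'z) set"
    and m :: "('g \<rightharpoonup> 'y) \<Rightarrow> ('g \<rightharpoonup> 'y) \<Rightarrow> ('g \<rightharpoonup> 'y)"
    and m' :: "('h \<rightharpoonup> 'z) \<Rightarrow> ('h \<rightharpoonup> 'z) \<Rightarrow> ('h \<rightharpoonup> 'z)"
  assumes "groupoid G" and "groupoid G'" and "groupoid \<Gamma>"
    and "topspace T = carrier G" and "topspace T' = carrier G'"
    and "Hausdorff_space (subtopology T (gunits G))"
    and "Hausdorff_space (subtopology T' (gunits G'))"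
    and "grading G \<Gamma> c" and "grading G' \<Gamma> c'"
    and "monoid Y" and "one_cancellative Y"
    and "monoid Y'" and "one_cancellative Y'"
    and "function_semigroup G T c Y A m"
    and "function_semigroup G' T' c' Y' A' m'"
    and "exhaustive G Y (D_part G A)" and "exhaustive G' Y' (D_part G' A')"
    and "S_part G A = N_part G A" and "bumpy G T c Y m (Z_part G Y A) (S_part G A)"
    and "S_part G' A' = N_part G' A'" and "bumpy G' T' c' Y' m' (Z_part G' Y' A') (S_part G' A')"
    and "\<exists>\<phi>. semigroup_iso A m A' m' \<phi> \<and> graded_map c c' A \<phi> \<and> \<phi> ` D_part G A = D_part G' A'"
  shows "etale_groupoid G T \<and> etale_groupoid G' T' \<and>
    (\<exists>\<psi>. groupoid_iso G G' \<psi> \<and> homeomorphic_map T T' \<psi> \<and> (\<forall>g\<in>carrier G. c' (\<psi> g) = c g))"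
proof -
  interpret L: bumpy_semigroup G T c Y A m
    by (intro bumpy_semigroup.intro bumpy_semigroup_axioms.intro assms)
  interpret R: bumpy_semigroup G' T' c' Y' A' m'
    by (intro bumpy_semigroup.intro bumpy_semigroup_axioms.intro assms)
  obtain \<phi> where \<phi>: "semigroup_iso A m A' m' \<phi>" "graded_map c c' A \<phi>" "\<phi> ` D_part G A = D_part G' A'"
    using assms by blast
  interpret diagonal_iso G T c Y A m G' T' c' Y' A' m' \<phi>
    by unfold_locales (use \<phi> in simp_all)
  show ?thesis
    using L.etale R.etale \<psi>_groupoid_iso \<psi>_homeomorphic \<psi>_graded[OF \<phi>(2)] by blast
qed

end
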